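(* Let $D\subseteq\mathbb{R}^m$ be open, $f:D\to\mathbb{R}^m$ analytic, $t_0\in\mathbb{R}$, $y_0\in D$, and let $r\ge 1$ be an integer. For $h>0$ sufficiently small, let $y$ be the solution of $y'=f(y)$, $y(t_0)=y_0$, on $[t_0,t_0+h]$, and let $\omega$ be the polynomial (depending on $h$, of degree at most $r$) solving the truncated problem $$\omega'(t_0+ch)=\sum_{j=0}^{r-1}\hat P_j(c)\,\gamma_j(\omega),\quad c\in[0,1],\qquad \gamma_j(\omega)=\int_0^1\hat P_j(\tau) f(\omega(t_0+\tau h))\,\mathrm{d}\tau,\qquad \omega(t_0)=y_0 .$$ Then $$y(t_0+h)-\omega(t_0+h)=O(h^{2r+1})\qquad\text{as } h\to0^+ .$$
   Context: $\{\hat P_j\}_{j\ge 0}$ are the shifted Legendre polynomials on $[0,1]$, scaled to be orthonormal: $\deg \hat P_j=j$ and $\int_0^1 \hat P_i(x)\hat P_j(x)\,\mathrm{d}x=\delta_{ij}$ for all $i,j\ge 0$. Convention on "the" solution $\omega$: there are $\delta,h_0>0$ such that for $0<h\le h_0$ the truncated problem has exactly one polynomial solution with $\|\omega(t_0+ch)-y_0\|\le\delta$ for all $c\in[0,1]$; $\omega$ denotes this solution. *)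

theory Defs
  imports "HOL-Analysis.Analysis" "HOL-Computational_Algebra.Polynomial"
    "HOL-Library.Landau_Symbols"
begin

text \<open>
  Real analyticity in several variables: near every point of \<open>D\<close> the function is the sum of a
  power series indexed by multi-indices \<open>\<alpha> :: 'm \<Rightarrow> nat\<close>. The predicate \<open>has_sum\<close> expresses
  unconditional (in finite dimension: absolute) convergence.
\<close>
definition real_analytic_on :: "(real^'m \<Rightarrow> real^'n) \<Rightarrow> (real^'m) set \<Rightarrow> bool" where
  "real_analytic_on f D \<longleftrightarrow>
     (\<forall>x\<in>D. \<exists>\<rho>>0. \<exists>a :: ('m \<Rightarrow> nat) \<Rightarrow> real^'n. ball x \<rho> \<subseteq> D \<and>
        (\<forall>z\<in>ball x \<rho>.
           ((\<lambda>\<alpha>. (\<Prod>i\<in>UNIV. (z $ i - x $ i) ^ \<alpha> i) *\<^sub>R a \<alpha>) has_sum f z) UNIV))"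

text \<open>
  These conditions determine each \<open>P j\<close> up to its sign. The sign is immaterial for the truncated
  problem below, where \<open>P j\<close> enters once in front of and once inside the \<open>j\<close>-th coefficient.
\<close>
definition orthonormal_legendre :: "(nat \<Rightarrow> real poly) \<Rightarrow> bool" where
  "orthonormal_legendre P \<longleftrightarrow>
     (\<forall>j. degree (P j) = j) \<and>
     (\<forall>i j. integral {0..1} (\<lambda>x. poly (P i) x * poly (P j) x) = (if i = j then 1 else 0))"

definition ivp_solution ::
  "(real^'m \<Rightarrow> real^'m) \<Rightarrow> (real^'m) set \<Rightarrow> real \<Rightarrow> real^'m \<Rightarrow> real \<Rightarrow> (real \<Rightarrow> real^'m) \<Rightarrow> bool" where
  "ivp_solution f D t0 y0 h y \<longleftrightarrow>
     y t0 = y0 \<and>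
     (\<forall>t\<in>{t0..t0 + h}. y t \<in> D \<and>
        (y has_vector_derivative f (y t)) (at t within {t0..t0 + h}))"

definition vec_polynomial :: "nat \<Rightarrow> (real \<Rightarrow> real^'m) \<Rightarrow> bool" where
  "vec_polynomial r w \<longleftrightarrow> (\<exists>a :: nat \<Rightarrow> real^'m. \<forall>t. w t = (\<Sum>k\<le>r. t ^ k *\<^sub>R a k))"

definition \<gamma> ::
  "(nat \<Rightarrow> real poly) \<Rightarrow> (real^'m \<Rightarrow> real^'m) \<Rightarrow> real \<Rightarrow> real \<Rightarrow> nat \<Rightarrow> (real \<Rightarrow> real^'m) \<Rightarrow> real^'m" where
  "\<gamma> P f t0 h j w = integral {0..1} (\<lambda>\<tau>. poly (P j) \<tau> *\<^sub>R f (w (t0 + \<tau> * h)))"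

text \<open>
  As \<open>f\<close> is only meaningful on \<open>D\<close>, a solution is required to take values in \<open>D\<close>
  on \<open>[t0, t0 + h]\<close>.
\<close>
definition truncated_solution ::
  "(nat \<Rightarrow> real poly) \<Rightarrow> nat \<Rightarrow> (real^'m \<Rightarrow> real^'m) \<Rightarrow> (real^'m) set \<Rightarrow> real \<Rightarrow> real^'m \<Rightarrow> real \<Rightarrow>
     (real \<Rightarrow> real^'m) \<Rightarrow> bool" where
  "truncated_solution P r f D t0 y0 h w \<longleftrightarrow>
     vec_polynomial r w \<and> w t0 = y0 \<and>
     (\<forall>c\<in>{0..1}. w (t0 + c * h) \<in> D \<and>
        (w has_vector_derivative (\<Sum>j<r. poly (P j) c *\<^sub>R \<gamma> P f t0 h j w)) (at (t0 + c * h)))"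

definition near_solution ::
  "(nat \<Rightarrow> real poly) \<Rightarrow> nat \<Rightarrow> (real^'m \<Rightarrow> real^'m) \<Rightarrow> (real^'m) set \<Rightarrow> real \<Rightarrow> real^'m \<Rightarrow> real \<Rightarrow>
     real \<Rightarrow> (real \<Rightarrow> real^'m) \<Rightarrow> bool" where
  "near_solution P r f D t0 y0 \<delta> h w \<longleftrightarrow>
     truncated_solution P r f D t0 y0 h w \<and> (\<forall>c\<in>{0..1}. norm (w (t0 + c * h) - y0) \<le> \<delta>)"

definition well_posed_with ::
  "(nat \<Rightarrow> real poly) \<Rightarrow> nat \<Rightarrow> (real^'m \<Rightarrow> real^'m) \<Rightarrow> (real^'m) set \<Rightarrow> real \<Rightarrow> real^'m \<Rightarrow> real \<Rightarrow>
     real \<Rightarrow> bool" where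
  "well_posed_with P r f D t0 y0 \<delta> h0 \<longleftrightarrow>
     \<delta> > 0 \<and> h0 > 0 \<and> (\<forall>h\<in>{0<..h0}. \<exists>!w. near_solution P r f D t0 y0 \<delta> h w)"

end

theory Submission
  imports Defs
begin

text \<open>
  On \<open>[0,1]\<close>, in the variable \<open>c = (t - t0) / h\<close>, the two problems read
  \<open>Y = y0 + h \<integral>\<^sub>0\<^sup>c f(Y)\<close> and \<open>W = y0 + h \<integral>\<^sub>0\<^sup>c \<Pi> f(W)\<close>, where \<open>\<Pi>\<close> is the orthogonal projection
  onto the polynomials of degree less than \<open>r\<close>: the truncated Legendre sum is exactly that projection.
  The error is driven by the residual \<open>R = f(W) - \<Pi> f(W)\<close>, for which two things hold: it is small,
  \<open>R = O(h^r)\<close>, and it is orthogonal to all polynomials of degree less than \<open>r\<close>. Smallness alone gives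
  \<open>Y - W = O(h^(r+1))\<close>; orthogonality doubles the order at \<open>c = 1\<close>.

  Instead of derivatives in \<open>c\<close>, the proof counts powers of \<open>h\<close>. Call a function of \<open>(h,c)\<close>
  graded if it is a linear combination of monomials \<open>h^k c^j\<close> with \<open>j \<le> k\<close>, that is, a polynomial in
  \<open>h\<close> and \<open>h c\<close>. Graded functions form an algebra that is stable under \<open>h \<integral>\<^sub>0\<^sup>c\<close> and under \<open>\<Pi>\<close>. As \<open>f\<close> is
  approximated by its Taylor polynomials, the integral equations can be bootstrapped: both solutions
  agree with graded functions up to any power of \<open>h\<close> (\<open>integral_equation_expands\<close>). A monomial of degree
  \<open>j \<ge> r\<close> in \<open>c\<close> carries the factor \<open>h^r\<close>, while the others are annihilated by \<open>id - \<Pi>\<close>. Hence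
  \<open>R = O(h^r)\<close> (\<open>residual_uniform_O\<close>), and by orthogonality \<open>\<integral> G R = O(h^(2r))\<close> for graded \<open>G\<close>
  (\<open>residual_graded_integral\<close>).

  For the doubling, write \<open>f(Y) - f(W) = A (Y - W) + O(h^(2r))\<close> with a graded matrix \<open>A\<close>
  (\<open>polynomial_difference\<close>), so that the error \<open>e = Y - W\<close> solves \<open>e = h \<integral>\<^sub>0\<^sup>c (A e + R + O(h^(2r)))\<close>.
  The moments \<open>\<integral> G e\<close> with graded \<open>G\<close> are \<open>O(h^(2r))\<close>: integration by parts moves the operator \<open>h \<integral>\<close>
  from \<open>e\<close> to \<open>G\<close>, which raises the order of \<open>G\<close> by one and produces a moment of \<open>A e\<close>, the moment of \<open>R\<close>
  just mentioned, and a negligible term; after at most \<open>r - 1\<close> rounds the trivial bound \<open>h^(r-1) h^(r+1)\<close>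
  suffices. In effect these are Picard steps for the adjoint linear equation. Finally
  \<open>e(1) = h \<integral> (A e + R + O(h^(2r))) = O(h^(2r+1))\<close> (\<open>superconvergence\<close>, \<open>truncation_error\<close>).

  Well-posedness comes from Banach's fixed point theorem for every sufficiently small \<open>\<delta>\<close>
  (\<open>well_posed_near\<close>). A prescribed, possibly large \<open>\<delta>\<close> reduces to this case: for small \<open>h\<close> the solution
  found in a smaller ball is also a solution for \<open>\<delta>\<close>, hence by uniqueness it is the given one.
\<close>

section \<open>Local bounds for analytic maps\<close>

lemma abs_has_sum_le_multiple:
  fixes c w :: "'i \<Rightarrow> real"
  assumes "(c has_sum u) A" and "((\<lambda>\<alpha>. \<bar>w \<alpha>\<bar>) has_sum S) A" and "\<And>\<alpha>. \<alpha> \<in> A \<Longrightarrow> \<bar>c \<alpha>\<bar> \<le> K * \<bar>w \<alpha>\<bar>"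
  shows "\<bar>u\<bar> \<le> K * S"
proof -
  have KS: "((\<lambda>\<alpha>. K * \<bar>w \<alpha>\<bar>) has_sum K * S) A"
    using assms(2) by (rule has_sum_cmult_right)
  have "u \<le> K * S"
    using assms(3) by (intro has_sum_mono[OF assms(1) KS]) fastforce
  moreover have "- u \<le> K * S"
    using assms(1,3) by (intro has_sum_mono[OF _ KS, of "\<lambda>\<alpha>. - c \<alpha>"]) (fastforce simp: has_sum_uminus)+
  ultimately show ?thesis by linarith
qed

abbreviation mdeg :: "('m::finite \<Rightarrow> nat) \<Rightarrow> nat" where
  "mdeg \<alpha> \<equiv> (\<Sum>i\<in>UNIV. \<alpha> i)"

abbreviation mpow :: "real^'m \<Rightarrow> ('m::finite \<Rightarrow> nat) \<Rightarrow> real" where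
  "mpow u \<alpha> \<equiv> (\<Prod>i\<in>UNIV. (u $ i) ^ \<alpha> i)"

lemma mpow_scaleR: "mpow (s *\<^sub>R u) \<alpha> = s ^ mdeg \<alpha> * mpow u \<alpha>"
  by (simp add: power_mult_distrib prod.distrib power_sum)

lemma abs_mpow_le:
  assumes "\<And>i. \<bar>u $ i\<bar> \<le> s"
  shows "\<bar>mpow u \<alpha>\<bar> \<le> s ^ mdeg \<alpha>"
proof -
  have "\<bar>mpow u \<alpha>\<bar> = (\<Prod>i\<in>UNIV. \<bar>u $ i\<bar> ^ \<alpha> i)"
    by (simp add: abs_prod power_abs)
  also have "\<dots> \<le> (\<Prod>i\<in>UNIV. s ^ \<alpha> i)"
    by (intro prod_mono) (auto intro: power_mono assms)
  finally show ?thesis by (simp add: power_sum)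
qed

lemma finite_mdeg_less: "finite {\<alpha> :: 'm::finite \<Rightarrow> nat. mdeg \<alpha> < N}"
proof (rule finite_subset)
  show "{\<alpha> :: 'm \<Rightarrow> nat. mdeg \<alpha> < N} \<subseteq> PiE UNIV (\<lambda>_. {..<N})"
  proof
    fix \<alpha> :: "'m \<Rightarrow> nat" assume "\<alpha> \<in> {\<alpha>. mdeg \<alpha> < N}"
    moreover have "\<alpha> i \<le> mdeg \<alpha>" for i
      by (rule member_le_sum) auto
    ultimately have "\<alpha> i < N" for i by (metis mem_Collect_eq order_le_less_trans)
    then show "\<alpha> \<in> PiE UNIV (\<lambda>_. {..<N})" by auto
  qed
qed (auto intro: finite_PiE)

text \<open>
  Halving the radius pays for the factor \<open>mdeg \<alpha>\<close> that differentiating a monomial produces,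
  since \<open>n \<le> 2 ^ n\<close>. The bound is a constant times the modulus of the same monomial at the corner
  \<open>(s, \<dots>, s)\<close>, which is what makes a power series converging at the corner Lipschitz.
\<close>
lemma abs_mpow_diff_le:
  assumes "0 < s" and u: "\<And>i. \<bar>u $ i\<bar> \<le> s / 2" and v: "\<And>i. \<bar>v $ i\<bar> \<le> s / 2"
  shows "\<bar>mpow u \<alpha> - mpow v \<alpha>\<bar> \<le> 2 / s * norm (u - v) * s ^ mdeg \<alpha>"
proof -
  define p q where "p = (2 / s) *\<^sub>R u" and "q = (2 / s) *\<^sub>R v"
  have p1: "\<bar>p $ i\<bar> \<le> 1" and q1: "\<bar>q $ i\<bar> \<le> 1" for i
    using u[of i] v[of i] \<open>0 < s\<close> by (simp_all add: p_def q_def abs_mult field_simps)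
  have "\<bar>mpow p \<alpha> - mpow q \<alpha>\<bar> \<le> (\<Sum>i\<in>UNIV. \<bar>(p $ i) ^ \<alpha> i - (q $ i) ^ \<alpha> i\<bar>)"
    using norm_prod_diff[of UNIV "\<lambda>i. (p $ i) ^ \<alpha> i" "\<lambda>i. (q $ i) ^ \<alpha> i"] p1 q1
    by (simp add: power_abs power_le_one)
  also have "\<dots> \<le> (\<Sum>i\<in>UNIV. real (\<alpha> i) * norm (p - q))"
  proof (rule sum_mono)
    fix i
    have "\<bar>(p $ i) ^ \<alpha> i - (q $ i) ^ \<alpha> i\<bar> \<le> real (\<alpha> i) * \<bar>p $ i - q $ i\<bar>"
      using norm_power_diff[of "p $ i" "q $ i" "\<alpha> i"] p1[of i] q1[of i] by simp
    also have "\<bar>p $ i - q $ i\<bar> \<le> norm (p - q)"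
      using component_le_norm_cart[of "p - q" i] by simp
    finally show "\<bar>(p $ i) ^ \<alpha> i - (q $ i) ^ \<alpha> i\<bar> \<le> real (\<alpha> i) * norm (p - q)"
      by (simp add: mult_left_mono)
  qed
  also have "\<dots> = real (mdeg \<alpha>) * norm (p - q)"
    by (simp add: sum_distrib_right)
  also have "norm (p - q) = 2 / s * norm (u - v)"
    using \<open>0 < s\<close> by (simp add: p_def q_def flip: scaleR_diff_right)
  finally have 1: "\<bar>mpow p \<alpha> - mpow q \<alpha>\<bar> \<le> real (mdeg \<alpha>) * (2 / s * norm (u - v))" .
  have "u = (s / 2) *\<^sub>R p" "v = (s / 2) *\<^sub>R q"
    using \<open>0 < s\<close> by (simp_all add: p_def q_def)
  then have "mpow u \<alpha> - mpow v \<alpha> = (s / 2) ^ mdeg \<alpha> * (mpow p \<alpha> - mpow q \<alpha>)"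
    by (simp only: mpow_scaleR right_diff_distrib)
  then have "\<bar>mpow u \<alpha> - mpow v \<alpha>\<bar> = (s / 2) ^ mdeg \<alpha> * \<bar>mpow p \<alpha> - mpow q \<alpha>\<bar>"
    using \<open>0 < s\<close> by (simp add: abs_mult)
  also have "\<dots> \<le> (s / 2) ^ mdeg \<alpha> * (real (mdeg \<alpha>) * (2 / s * norm (u - v)))"
    using 1 \<open>0 < s\<close> by (intro mult_left_mono) auto
  also have "\<dots> = (real (mdeg \<alpha>) / 2 ^ mdeg \<alpha>) * (2 / s * norm (u - v) * s ^ mdeg \<alpha>)"
    by (simp add: power_divide)
  also have "\<dots> \<le> 1 * (2 / s * norm (u - v) * s ^ mdeg \<alpha>)"
    using \<open>0 < s\<close> of_nat_less_two_power[of "mdeg \<alpha>", where ?'a = real]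
    by (intro mult_right_mono) (auto simp: less_imp_le)
  finally show ?thesis by simp
qed

text \<open>
  All later arguments use only these two consequences of analyticity near \<open>x\<close>: a Lipschitz bound
  and polynomial approximation to every order, both on one fixed ball. Unconditional convergence at
  the corner \<open>x + (s, \<dots>, s)\<close> gives \<open>\<Sum>\<bar>a \<alpha>\<bar> s ^ mdeg \<alpha> < \<infinity>\<close>, which dominates the series and its tails on
  the ball of radius \<open>s / 2\<close>.
\<close>
lemma real_analytic_on_local:
  fixes f :: "real^'m \<Rightarrow> real^'n"
  assumes "real_analytic_on f D" "x \<in> D"
  obtains d L where "d > 0" "cball x d \<subseteq> D" "L \<ge> 0"
    "\<And>z w i. z \<in> cball x d \<Longrightarrow> w \<in> cball x d \<Longrightarrow> \<bar>f z $ i - f w $ i\<bar> \<le> L * norm (z - w)"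
    "\<And>N i. \<exists>T. real_polynomial_function T \<and>
       (\<exists>C. \<forall>z\<in>cball x d. \<bar>f z $ i - T z\<bar> \<le> C * norm (z - x) ^ N)"
proof -
  obtain \<rho> a where \<rho>: "\<rho> > 0" "ball x \<rho> \<subseteq> D"
    and sum_f: "\<And>z. z \<in> ball x \<rho> \<Longrightarrow> ((\<lambda>\<alpha>. mpow (z - x) \<alpha> *\<^sub>R a \<alpha>) has_sum f z) UNIV"
    using assms unfolding real_analytic_on_def vector_minus_component by blast
  \<comment> \<open>The corner of the cube with half side s has norm at most \<open>CARD('m) * s < \<rho>\<close>.\<close>
  define s where "s = \<rho> / (2 * CARD('m))"
  have "s > 0" using \<rho> by (simp add: s_def)
  have norm_s: "norm (\<chi> i::'m. s) < \<rho>"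
  proof -
    have "norm (\<chi> i::'m. s) \<le> (\<Sum>i::'m\<in>UNIV. \<bar>(\<chi> i::'m. s) $ i\<bar>)"
      by (rule norm_le_l1_cart)
    also have "\<dots> = \<rho> / 2" using \<rho> by (simp add: s_def)
    finally show ?thesis using \<rho> by simp
  qed
  have s_le: "s / 2 < \<rho>"
  proof -
    have "s \<le> \<rho> / 2" unfolding s_def using \<rho> by (simp add: field_simps)
    then show ?thesis using \<rho> by simp
  qed
  have comp: "((\<lambda>\<alpha>. mpow (z - x) \<alpha> * a \<alpha> $ i) has_sum f z $ i) UNIV" if "z \<in> ball x \<rho>" for z i
    using has_sum_bounded_linear[OF bounded_linear_vec_nth sum_f[OF that], of i] by simp
  define w where "w = (\<lambda>i \<alpha>. s ^ mdeg \<alpha> * a \<alpha> $ i)"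
  define S where "S = (\<lambda>i. infsum (\<lambda>\<alpha>. \<bar>w i \<alpha>\<bar>) UNIV)"
  have w: "((\<lambda>\<alpha>. \<bar>w i \<alpha>\<bar>) has_sum S i) UNIV" for i
  proof -
    have "(w i has_sum f (x + (\<chi> i. s)) $ i) UNIV"
      using comp[of "x + (\<chi> i. s)" i] norm_s by (simp add: w_def dist_norm power_sum)
    then show ?thesis
      unfolding S_def by (metis has_sum_infsum summable_on_def summable_on_iff_abs_summable_on_real real_norm_def summable_on_cong)
  qed
  have S0: "S i \<ge> 0" for i unfolding S_def by (intro infsum_nonneg) auto
  have comp_le: "\<bar>(z - x) $ i\<bar> \<le> s / 2" if "z \<in> cball x (s / 2)" for z i
    using that component_le_norm_cart[of "z - x" i] by (simp add: dist_norm norm_minus_commute)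
  have in_ball: "z \<in> ball x \<rho>" if "z \<in> cball x (s / 2)" for z
    using that s_le by auto
  show thesis
  proof (rule that[of "s / 2" "\<Sum>i\<in>UNIV. 2 / s * S i"])
    show "s / 2 > 0" using \<open>s > 0\<close> by simp
    show "cball x (s / 2) \<subseteq> D" using in_ball \<rho>(2) by blast
    show "(\<Sum>i\<in>UNIV. 2 / s * S i) \<ge> 0" using S0 \<open>s > 0\<close> by (intro sum_nonneg) auto
    show "\<bar>f z $ i - f v $ i\<bar> \<le> (\<Sum>i\<in>UNIV. 2 / s * S i) * norm (z - v)"
      if z: "z \<in> cball x (s / 2)" and v: "v \<in> cball x (s / 2)" for z v i
    proof -
      have "((\<lambda>\<alpha>. mpow (z - x) \<alpha> * a \<alpha> $ i - mpow (v - x) \<alpha> * a \<alpha> $ i) has_sum f z $ i - f v $ i) UNIV"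
        using has_sum_add[OF comp[OF in_ball[OF z]], of "\<lambda>\<alpha>. - (mpow (v - x) \<alpha> * a \<alpha> $ i)" "- f v $ i" i]
          comp[OF in_ball[OF v], of i] by (simp add: has_sum_uminus)
      then have "\<bar>f z $ i - f v $ i\<bar> \<le> (2 / s * norm (z - v)) * S i"
      proof (rule abs_has_sum_le_multiple[OF _ w])
        fix \<alpha>
        have "\<bar>mpow (z - x) \<alpha> * a \<alpha> $ i - mpow (v - x) \<alpha> * a \<alpha> $ i\<bar>
            = \<bar>mpow (z - x) \<alpha> - mpow (v - x) \<alpha>\<bar> * \<bar>a \<alpha> $ i\<bar>"
          by (simp add: left_diff_distrib flip: abs_mult)
        also have "\<dots> \<le> (2 / s * norm ((z - x) - (v - x)) * s ^ mdeg \<alpha>) * \<bar>a \<alpha> $ i\<bar>"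
          by (intro mult_right_mono abs_mpow_diff_le comp_le z v \<open>s > 0\<close>) auto
        finally show "\<bar>mpow (z - x) \<alpha> * a \<alpha> $ i - mpow (v - x) \<alpha> * a \<alpha> $ i\<bar> \<le> 2 / s * norm (z - v) * \<bar>w i \<alpha>\<bar>"
          using \<open>s > 0\<close> by (simp add: w_def abs_mult)
      qed
      also have "\<dots> = (2 / s * S i) * norm (z - v)" by simp
      also have "\<dots> \<le> (\<Sum>i\<in>UNIV. 2 / s * S i) * norm (z - v)"
        using S0 \<open>s > 0\<close> by (intro mult_right_mono member_le_sum) auto
      finally show ?thesis .
    qed
    show "\<exists>T. real_polynomial_function T \<and>
       (\<exists>C. \<forall>z\<in>cball x (s / 2). \<bar>f z $ i - T z\<bar> \<le> C * norm (z - x) ^ N)" for N i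
    proof (intro exI[of _ "\<lambda>z. \<Sum>\<alpha> | mdeg \<alpha> < N. mpow (z - x) \<alpha> * a \<alpha> $ i"]
        exI[of _ "S i / s ^ N"] conjI ballI)
      have "real_polynomial_function (\<lambda>z::real^'m. z $ j - x $ j)" for j
        by (intro real_polynomial_function_diff real_polynomial_function.intros(1)
            real_polynomial_function.intros(2) bounded_linear_vec_nth)
      then show "real_polynomial_function (\<lambda>z. \<Sum>\<alpha> | mdeg \<alpha> < N. mpow (z - x) \<alpha> * a \<alpha> $ i)"
        by (auto intro!: real_polynomial_function_sum finite_mdeg_less real_polynomial_function.intros(4)
            real_polynomial_function_prod real_polynomial_function_power real_polynomial_function.intros(2))
      fix z assume z: "z \<in> cball x (s / 2)"
      have "((\<lambda>\<alpha>. mpow (z - x) \<alpha> * a \<alpha> $ i) has_sum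
          (f z $ i - (\<Sum>\<alpha> | mdeg \<alpha> < N. mpow (z - x) \<alpha> * a \<alpha> $ i))) (UNIV - {\<alpha> :: 'm \<Rightarrow> nat. mdeg \<alpha> < N})"
        by (intro has_sum_Diff comp in_ball z has_sum_finite finite_mdeg_less) auto
      moreover have "(\<lambda>\<alpha>. \<bar>w i \<alpha>\<bar>) summable_on (UNIV - {\<alpha> :: 'm \<Rightarrow> nat. mdeg \<alpha> < N})"
        using w[of i] by (meson summable_on_def summable_on_subset_banach subset_UNIV)
      then obtain S' where S': "((\<lambda>\<alpha>. \<bar>w i \<alpha>\<bar>) has_sum S') (UNIV - {\<alpha> :: 'm \<Rightarrow> nat. mdeg \<alpha> < N})"
        by (auto simp: summable_on_def)
      ultimately have "\<bar>f z $ i - (\<Sum>\<alpha> | mdeg \<alpha> < N. mpow (z - x) \<alpha> * a \<alpha> $ i)\<bar>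
          \<le> (norm (z - x) / s) ^ N * S'"
      proof (rule abs_has_sum_le_multiple)
        fix \<alpha> :: "'m \<Rightarrow> nat" assume "\<alpha> \<in> UNIV - {\<alpha>. mdeg \<alpha> < N}"
        then have N: "N \<le> mdeg \<alpha>" by simp
        have q: "norm (z - x) / s \<le> 1"
          using z \<open>s > 0\<close> by (simp add: dist_norm norm_minus_commute field_simps)
        have "\<bar>mpow (z - x) \<alpha>\<bar> \<le> norm (z - x) ^ mdeg \<alpha>"
          by (intro abs_mpow_le component_le_norm_cart)
        also have "\<dots> = (norm (z - x) / s) ^ mdeg \<alpha> * s ^ mdeg \<alpha>"
          using \<open>s > 0\<close> by (simp add: power_divide)
        also have "\<dots> \<le> (norm (z - x) / s) ^ N * s ^ mdeg \<alpha>"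
          using \<open>s > 0\<close> q by (intro mult_right_mono power_decreasing N) auto
        finally show "\<bar>mpow (z - x) \<alpha> * a \<alpha> $ i\<bar> \<le> (norm (z - x) / s) ^ N * \<bar>w i \<alpha>\<bar>"
          using \<open>s > 0\<close> by (simp add: w_def abs_mult mult_right_mono flip: mult.assoc)
      qed
      also have "\<dots> \<le> (norm (z - x) / s) ^ N * S i"
        using \<open>s > 0\<close> has_sum_mono2[OF S' w] by (intro mult_left_mono) auto
      finally show "\<bar>f z $ i - (\<Sum>\<alpha> | mdeg \<alpha> < N. mpow (z - x) \<alpha> * a \<alpha> $ i)\<bar> \<le> S i / s ^ N * norm (z - x) ^ N"
        by (simp add: power_divide mult.commute)
    qed
  qed
qed

section \<open>Error terms that are uniform in the stage variable\<close>

definition uniform_O :: "nat \<Rightarrow> (real \<Rightarrow> real \<Rightarrow> real) \<Rightarrow> bool" where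
  "uniform_O n g \<longleftrightarrow> (\<exists>C. \<forall>\<^sub>F h in at_right 0. \<forall>c\<in>{0..1}. \<bar>g h c\<bar> \<le> C * h ^ n)"

lemma at_right_0_less: "e > 0 \<Longrightarrow> \<forall>\<^sub>F h::real in at_right 0. 0 < h \<and> h \<le> e"
  unfolding eventually_at_right_field by (rule exI[of _ e]) auto

lemma uniform_O_I:
  assumes "\<forall>\<^sub>F h in at_right 0. \<forall>c\<in>{0..1}. \<bar>g h c\<bar> \<le> C * h ^ n"
  shows "uniform_O n g"
  using assms unfolding uniform_O_def by blast

text \<open>
  The eventual bounds on \<open>h\<close> and the sign of \<open>C\<close> come along because products and monotonicity in
  the exponent need them.
\<close>
lemma uniform_O_E:
  assumes "uniform_O n g"
  obtains C where "C > 0" "\<forall>\<^sub>F h in at_right 0. 0 < h \<and> h \<le> 1 \<and> (\<forall>c\<in>{0..1}. \<bar>g h c\<bar> \<le> C * h ^ n)"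
proof -
  from assms obtain C where C: "\<forall>\<^sub>F h in at_right 0. \<forall>c\<in>{0..1}. \<bar>g h c\<bar> \<le> C * h ^ n"
    unfolding uniform_O_def by blast
  have "\<forall>\<^sub>F h in at_right 0. 0 < h \<and> h \<le> 1 \<and> (\<forall>c\<in>{0..1}. \<bar>g h c\<bar> \<le> (\<bar>C\<bar> + 1) * h ^ n)"
    using C at_right_0_less[of 1, simplified]
  proof eventually_elim
    case (elim h)
    have "C * h ^ n \<le> (\<bar>C\<bar> + 1) * h ^ n" using elim by (intro mult_right_mono) auto
    with elim show ?case by (meson order_trans)
  qed
  then show thesis by (intro that[of "\<bar>C\<bar> + 1"]) auto
qed

lemma uniform_O_le:
  assumes "uniform_O n g" and "\<forall>\<^sub>F h in at_right 0. \<forall>c\<in>{0..1}. \<bar>f h c\<bar> \<le> \<bar>g h c\<bar>"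
  shows "uniform_O n f"
proof -
  from assms(1) obtain C where "\<forall>\<^sub>F h in at_right 0. \<forall>c\<in>{0..1}. \<bar>g h c\<bar> \<le> C * h ^ n"
    unfolding uniform_O_def by blast
  with assms(2) have "\<forall>\<^sub>F h in at_right 0. \<forall>c\<in>{0..1}. \<bar>f h c\<bar> \<le> C * h ^ n"
    by eventually_elim (meson order_trans)
  then show ?thesis by (rule uniform_O_I)
qed

lemma uniform_O_cong:
  assumes "uniform_O n g" and "\<forall>\<^sub>F h in at_right 0. \<forall>c\<in>{0..1}. f h c = g h c"
  shows "uniform_O n f"
  using assms(1) by (rule uniform_O_le) (use assms(2) in eventually_elim, simp)

lemma uniform_O_mono:
  assumes "uniform_O n g" and "k \<le> n"
  shows "uniform_O k g"
proof -
  obtain C where "C > 0" and C: "\<forall>\<^sub>F h in at_right 0. 0 < h \<and> h \<le> 1 \<and> (\<forall>c\<in>{0..1}. \<bar>g h c\<bar> \<le> C * h ^ n)"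
    using assms(1) by (rule uniform_O_E)
  have "\<forall>\<^sub>F h in at_right 0. \<forall>c\<in>{0..1}. \<bar>g h c\<bar> \<le> C * h ^ k"
    using C
  proof eventually_elim
    case (elim h)
    have "C * h ^ n \<le> C * h ^ k"
      using elim \<open>C > 0\<close> assms(2) by (intro mult_left_mono power_decreasing) auto
    with elim show ?case by (meson order_trans)
  qed
  then show ?thesis by (rule uniform_O_I)
qed

lemma uniform_O_0 [simp]: "uniform_O n (\<lambda>h c. 0)"
  by (rule uniform_O_I[of _ 0]) simp

lemma uniform_O_add:
  assumes "uniform_O n f" "uniform_O n g"
  shows "uniform_O n (\<lambda>h c. f h c + g h c)"
proof -
  obtain A where A: "\<forall>\<^sub>F h in at_right 0. 0 < h \<and> h \<le> 1 \<and> (\<forall>c\<in>{0..1}. \<bar>f h c\<bar> \<le> A * h ^ n)"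
    using assms(1) by (rule uniform_O_E)
  obtain B where B: "\<forall>\<^sub>F h in at_right 0. 0 < h \<and> h \<le> 1 \<and> (\<forall>c\<in>{0..1}. \<bar>g h c\<bar> \<le> B * h ^ n)"
    using assms(2) by (rule uniform_O_E)
  have "\<forall>\<^sub>F h in at_right 0. \<forall>c\<in>{0..1}. \<bar>f h c + g h c\<bar> \<le> (A + B) * h ^ n"
    using A B by eventually_elim (force simp: distrib_right)
  then show ?thesis by (rule uniform_O_I)
qed

lemma uniform_O_minus: "uniform_O n f \<Longrightarrow> uniform_O n (\<lambda>h c. - f h c)"
  by (simp add: uniform_O_def)

lemma uniform_O_diff: "uniform_O n f \<Longrightarrow> uniform_O n g \<Longrightarrow> uniform_O n (\<lambda>h c. f h c - g h c)"
  using uniform_O_add[of n f "\<lambda>h c. - g h c"] uniform_O_minus[of n g] by simp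

lemma uniform_O_sum: "(\<And>i. i \<in> I \<Longrightarrow> uniform_O n (f i)) \<Longrightarrow> uniform_O n (\<lambda>h c. \<Sum>i\<in>I. f i h c)"
  by (induction I rule: infinite_finite_induct) (auto intro: uniform_O_add)

lemma uniform_O_mult:
  assumes "uniform_O m f" "uniform_O n g"
  shows "uniform_O (m + n) (\<lambda>h c. f h c * g h c)"
proof -
  obtain A where A: "A > 0" "\<forall>\<^sub>F h in at_right 0. 0 < h \<and> h \<le> 1 \<and> (\<forall>c\<in>{0..1}. \<bar>f h c\<bar> \<le> A * h ^ m)"
    using assms(1) by (rule uniform_O_E)
  obtain B where B: "\<forall>\<^sub>F h in at_right 0. 0 < h \<and> h \<le> 1 \<and> (\<forall>c\<in>{0..1}. \<bar>g h c\<bar> \<le> B * h ^ n)"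
    using assms(2) by (rule uniform_O_E)
  have "\<forall>\<^sub>F h in at_right 0. \<forall>c\<in>{0..1}. \<bar>f h c * g h c\<bar> \<le> (A * B) * h ^ (m + n)"
    using A(2) B
  proof eventually_elim
    case (elim h)
    show ?case
    proof
      fix c :: real assume c: "c \<in> {0..1}"
      have "\<bar>f h c * g h c\<bar> = \<bar>f h c\<bar> * \<bar>g h c\<bar>" by (simp add: abs_mult)
      also have "\<dots> \<le> (A * h ^ m) * (B * h ^ n)"
        using elim c A(1) by (intro mult_mono) auto
      finally show "\<bar>f h c * g h c\<bar> \<le> (A * B) * h ^ (m + n)" by (simp add: power_add mult_ac)
    qed
  qed
  then show ?thesis by (rule uniform_O_I)
qed

lemma uniform_O_h_power: "uniform_O n (\<lambda>h c. h ^ n)"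
  unfolding uniform_O_def using at_right_0_less[of 1]
  by (intro exI[of _ 1]) (auto elim!: eventually_mono)

lemma uniform_O_of_continuous:
  assumes "continuous_on {0..1} g"
  shows "uniform_O 0 (\<lambda>h. g)"
proof -
  have "bounded (g ` {0..1})"
    by (intro compact_imp_bounded compact_continuous_image assms) simp
  then obtain B where "\<forall>c\<in>{0..1}. \<bar>g c\<bar> \<le> B" by (auto simp: bounded_iff)
  then show ?thesis by (intro uniform_O_I[of _ B]) simp
qed

text \<open>
  For non-integrable \<open>g h\<close> the bound holds because the integral is then 0 by convention.
\<close>
lemma uniform_O_integral:
  assumes "uniform_O n g"
  shows "uniform_O n (\<lambda>h c. integral {0..c} (g h))"
proof -
  obtain C where "C > 0" and C: "\<forall>\<^sub>F h in at_right 0. 0 < h \<and> h \<le> 1 \<and> (\<forall>c\<in>{0..1}. \<bar>g h c\<bar> \<le> C * h ^ n)"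
    using assms(1) by (rule uniform_O_E)
  have "\<forall>\<^sub>F h in at_right 0. \<forall>c\<in>{0..1}. \<bar>integral {0..c} (g h)\<bar> \<le> C * h ^ n"
    using C
  proof eventually_elim
    case (elim h)
    show ?case
    proof
      fix c :: real assume c: "c \<in> {0..1}"
      show "\<bar>integral {0..c} (g h)\<bar> \<le> C * h ^ n"
      proof (cases "g h integrable_on {0..c}")
        case True
        have "norm (integral {0..c} (g h)) \<le> integral {0..c} (\<lambda>_. C * h ^ n)"
          using elim c by (intro integral_norm_bound_integral True) auto
        also have "\<dots> = c * (C * h ^ n)" using c by simp
        also have "\<dots> \<le> 1 * (C * h ^ n)" using c elim \<open>C > 0\<close> by (intro mult_right_mono) auto
        finally show ?thesis by simp
      next
        case False
        then show ?thesis using elim \<open>C > 0\<close> by (simp add: not_integrable_integral)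
      qed
    qed
  qed
  then show ?thesis by (rule uniform_O_I)
qed

lemma uniform_O_fix:
  assumes "uniform_O n g" "c0 \<in> {0..1}"
  shows "uniform_O n (\<lambda>h c. g h c0)"
proof -
  from assms(1) obtain C where C: "\<forall>\<^sub>F h in at_right 0. \<forall>c\<in>{0..1}. \<bar>g h c\<bar> \<le> C * h ^ n"
    unfolding uniform_O_def by blast
  have "\<forall>\<^sub>F h in at_right 0. \<forall>c\<in>{0..1::real}. \<bar>g h c0\<bar> \<le> C * h ^ n"
    using C by (rule eventually_mono) (use assms(2) in blast)
  then show ?thesis by (rule uniform_O_I)
qed

lemma uniform_O_integral_0_1: "uniform_O n g \<Longrightarrow> uniform_O n (\<lambda>h c. integral {0..1} (g h))"
  using uniform_O_fix[OF uniform_O_integral, of n g 1] by simp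

lemma uniform_O_h_times:
  assumes "uniform_O n g"
  shows "uniform_O (Suc n) (\<lambda>h c. h * g h c)"
  using uniform_O_mult[OF uniform_O_h_power[of 1] assms] by simp

lemma uniform_O_abs: "uniform_O n g \<Longrightarrow> uniform_O n (\<lambda>h c. \<bar>g h c\<bar>)"
  by (simp add: uniform_O_def)

lemma uniform_O_power: "uniform_O k g \<Longrightarrow> uniform_O (N * k) (\<lambda>h c. g h c ^ N)"
proof (induction N)
  case 0
  show ?case using uniform_O_of_continuous[of "\<lambda>_. 1"] by simp
next
  case (Suc N)
  from uniform_O_mult[OF Suc.prems Suc.IH[OF Suc.prems]] show ?case by simp
qed

lemma uniform_O_norm_components:
  fixes U :: "real \<Rightarrow> real \<Rightarrow> real^'m"
  assumes "\<And>l. uniform_O k (\<lambda>h c. U h c $ l)"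
  shows "uniform_O k (\<lambda>h c. norm (U h c))"
proof (rule uniform_O_le)
  show "uniform_O k (\<lambda>h c. \<Sum>l\<in>UNIV. \<bar>U h c $ l\<bar>)" by (intro uniform_O_sum uniform_O_abs assms)
  show "\<forall>\<^sub>F h in at_right 0. \<forall>c\<in>{0..1}. \<bar>norm (U h c)\<bar> \<le> \<bar>\<Sum>l\<in>UNIV. \<bar>U h c $ l\<bar>\<bar>"
    by (intro always_eventually allI ballI) (use norm_le_l1_cart in \<open>fastforce intro: order_trans[OF _ abs_ge_self]\<close>)
qed

section \<open>Graded expansions\<close>

text \<open>
  The condition \<open>j \<le> k\<close> ties each power of \<open>c\<close> to a power of \<open>h\<close>, as in a Taylor expansion in
  \<open>t - t0 = h c\<close>; it is what turns high degree in \<open>c\<close> into smallness. The parameter \<open>n\<close> is a lower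
  bound for the order in \<open>h\<close>.
\<close>
inductive graded :: "nat \<Rightarrow> (real \<Rightarrow> real \<Rightarrow> real) \<Rightarrow> bool" for n where
  monom: "n \<le> k \<Longrightarrow> j \<le> k \<Longrightarrow> graded n (\<lambda>h c. a * h ^ k * c ^ j)"
| add: "graded n F \<Longrightarrow> graded n G \<Longrightarrow> graded n (\<lambda>h c. F h c + G h c)"

lemma graded_const: "graded 0 (\<lambda>h c. a)"
  using graded.monom[of 0 0 0 a] by simp

lemma graded_0: "graded n (\<lambda>h c. 0)"
  using graded.monom[of n n 0 0] by simp

lemma graded_sum: "(\<And>i. i \<in> I \<Longrightarrow> graded n (f i)) \<Longrightarrow> graded n (\<lambda>h c. \<Sum>i\<in>I. f i h c)"
  by (induction I rule: infinite_finite_induct) (auto intro: graded.add graded_0)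

lemma graded_uniform_O: "graded n G \<Longrightarrow> uniform_O n G"
proof (induction rule: graded.induct)
  case (monom k j a)
  have "uniform_O (0 + k) (\<lambda>h c. (a * c ^ j) * h ^ k)"
    by (intro uniform_O_mult uniform_O_h_power uniform_O_of_continuous continuous_intros)
  then show ?case using monom by (auto intro: uniform_O_mono simp: mult_ac)
qed (auto intro: uniform_O_add)

lemma graded_continuous: "graded n G \<Longrightarrow> continuous_on S (G h)"
  by (induction rule: graded.induct) (auto intro!: continuous_intros)

lemma graded_mult:
  assumes "graded m F" "graded n G"
  shows "graded (m + n) (\<lambda>h c. F h c * G h c)"
  using assms(1)
proof (induction rule: graded.induct)
  case m: (monom k j a)
  show ?case using assms(2)
  proof (induction rule: graded.induct)
    case (monom l i b)
    then have "graded (m + n) (\<lambda>h c. (a * b) * h ^ (k + l) * c ^ (j + i))"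
      using m by (intro graded.monom) auto
    then show ?case by (simp add: power_add mult_ac)
  qed (auto simp: distrib_left intro: graded.add)
qed (auto simp: distrib_right intro: graded.add)

lemma graded_minus: "graded n G \<Longrightarrow> graded n (\<lambda>h c. - G h c)"
  using graded_mult[OF graded_const[of "-1"], of n G] by simp

text \<open>
  \<open>H\<close> is \<open>h \<integral>\<^sub>c\<^sup>1 G\<close>. The antiderivative vanishing at 1 is the one without boundary terms when an
  integral from 0 is integrated by parts; the one vanishing at 0 follows from it.
\<close>
lemma graded_tail_integral:
  assumes "graded n G"
  shows "\<exists>H. graded (Suc n) H \<and> (\<forall>h. H h 1 = 0) \<and>
    (\<forall>h c. (H h has_vector_derivative - h * G h c) (at c))"
  using assms
proof (induction rule: graded.induct)
  case (monom k j a)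
  let ?b = "a / real (Suc j)"
  let ?H = "\<lambda>h c. ?b * h ^ Suc k * c ^ 0 + (- ?b) * h ^ Suc k * c ^ Suc j"
  have "graded (Suc n) ?H"
    using monom by (intro graded.add graded.monom) auto
  moreover have "(?H h has_vector_derivative - h * (a * h ^ k * c ^ j)) (at c)" for h c
  proof -
    have "(?H h has_real_derivative (- ?b) * h ^ Suc k * (real (Suc j) * c ^ j)) (at c)"
      by (auto intro!: derivative_eq_intros simp del: power_Suc)
    also have "(- ?b) * h ^ Suc k * (real (Suc j) * c ^ j) = - h * (a * h ^ k * c ^ j)"
      by (simp add: divide_simps)
    finally show ?thesis by (simp add: has_real_derivative_iff_has_vector_derivative)
  qed
  ultimately show ?case by (intro exI[of _ ?H]) simp
next
  case (add F G)
  then obtain HF HG where "graded (Suc n) HF" "\<And>h. HF h 1 = 0"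
    "\<And>h c. (HF h has_vector_derivative - h * F h c) (at c)"
    "graded (Suc n) HG" "\<And>h. HG h 1 = 0"
    "\<And>h c. (HG h has_vector_derivative - h * G h c) (at c)" by blast
  then show ?case
    by (intro exI[of _ "\<lambda>h c. HF h c + HG h c"])
       (auto intro!: graded.add derivative_eq_intros has_vector_derivative_add simp: distrib_left)
qed

lemma graded_integral:
  assumes "graded n G"
  shows "\<exists>H. graded (Suc n) H \<and> (\<forall>h. \<forall>c\<ge>0. H h c = h * integral {0..c} (G h))"
proof -
  obtain H where H: "graded (Suc n) H" "\<And>h c. (H h has_vector_derivative - h * G h c) (at c)"
    using graded_tail_integral[OF assms] by blast
  have "graded (Suc n) (\<lambda>h c. H h 0)" using H(1)
  proof (induction rule: graded.induct)
    case (monom k j a)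
    have "graded (Suc n) (\<lambda>h c. (a * 0 ^ j) * h ^ k * c ^ 0)"
      using monom by (intro graded.monom) auto
    then show ?case by (simp add: mult_ac)
  qed (auto intro: graded.add)
  then have "graded (Suc n) (\<lambda>h c. H h 0 + - H h c)"
    by (intro graded.add graded_minus H)
  moreover have "H h 0 + - H h c = h * integral {0..c} (G h)" if "c \<ge> 0" for h c
  proof -
    have "((\<lambda>s. - h * G h s) has_integral H h c - H h 0) {0..c}"
      using that H(2) by (intro fundamental_theorem_of_calculus) (auto intro: has_vector_derivative_at_within)
    then have "integral {0..c} (\<lambda>s. - h * G h s) = H h c - H h 0" by (rule integral_unique)
    then show ?thesis by simp
  qed
  ultimately show ?thesis by blast
qed

text \<open>
  The approximant may contain terms beyond \<open>h ^ N\<close>, so that the product of two approximants is again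
  one, without truncation.
\<close>
definition expands :: "nat \<Rightarrow> (real \<Rightarrow> real \<Rightarrow> real) \<Rightarrow> bool" where
  "expands N g \<longleftrightarrow> (\<exists>G. graded 0 G \<and> uniform_O N (\<lambda>h c. g h c - G h c))"

lemma expands_graded: "graded 0 G \<Longrightarrow> expands N G"
  unfolding expands_def by (intro exI[of _ G]) simp

lemma expands_uniform_O_0: "expands N g \<Longrightarrow> uniform_O 0 g"
proof -
  assume "expands N g"
  then obtain G where "graded 0 G" "uniform_O N (\<lambda>h c. g h c - G h c)"
    unfolding expands_def by blast
  then have "uniform_O 0 (\<lambda>h c. (g h c - G h c) + G h c)"
    using uniform_O_add[OF uniform_O_mono graded_uniform_O, of N "\<lambda>h c. g h c - G h c" 0 G] by simp
  then show "uniform_O 0 g" by simp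
qed

lemma expands_uniform_O:
  assumes "uniform_O N (\<lambda>h c. f h c - g h c)" "expands N g"
  shows "expands N f"
proof -
  obtain G where G: "graded 0 G" "uniform_O N (\<lambda>h c. g h c - G h c)"
    using assms(2) unfolding expands_def by blast
  have "uniform_O N (\<lambda>h c. f h c - G h c)"
    using uniform_O_add[OF assms(1) G(2)] by simp
  then show ?thesis using G(1) unfolding expands_def by blast
qed

lemma expands_cong:
  "expands N g \<Longrightarrow> \<forall>\<^sub>F h in at_right 0. \<forall>c\<in>{0..1}. f h c = g h c \<Longrightarrow> expands N f"
  by (erule expands_uniform_O[rotated], rule uniform_O_cong[OF uniform_O_0], erule eventually_mono) simp

lemma expands_add: "expands N f \<Longrightarrow> expands N g \<Longrightarrow> expands N (\<lambda>h c. f h c + g h c)"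
  unfolding expands_def
proof (elim exE conjE)
  fix F G assume "graded 0 F" "graded 0 G" "uniform_O N (\<lambda>h c. f h c - F h c)" "uniform_O N (\<lambda>h c. g h c - G h c)"
  then show "\<exists>G. graded 0 G \<and> uniform_O N (\<lambda>h c. f h c + g h c - G h c)"
    using uniform_O_add[of N "\<lambda>h c. f h c - F h c" "\<lambda>h c. g h c - G h c"]
    by (intro exI[of _ "\<lambda>h c. F h c + G h c"] conjI graded.add) (auto simp: algebra_simps)
qed

lemma expands_sum: "(\<And>i. i \<in> I \<Longrightarrow> expands N (f i)) \<Longrightarrow> expands N (\<lambda>h c. \<Sum>i\<in>I. f i h c)"
  by (induction I rule: infinite_finite_induct) (auto intro: expands_add expands_graded graded_0)

lemma expands_mult:
  assumes "expands N f" "expands N g"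
  shows "expands N (\<lambda>h c. f h c * g h c)"
proof -
  obtain F G where F: "graded 0 F" "uniform_O N (\<lambda>h c. f h c - F h c)"
    and G: "graded 0 G" "uniform_O N (\<lambda>h c. g h c - G h c)"
    using assms unfolding expands_def by blast
  have "uniform_O N (\<lambda>h c. f h c * (g h c - G h c) + (f h c - F h c) * G h c)"
    using uniform_O_mult[OF expands_uniform_O_0[OF assms(1)] G(2)] uniform_O_mult[OF F(2) graded_uniform_O[OF G(1)]]
    by (intro uniform_O_add) simp_all
  then show ?thesis
    unfolding expands_def using graded_mult[OF F(1) G(1)]
    by (intro exI[of _ "\<lambda>h c. F h c * G h c"]) (auto simp: algebra_simps)
qed

lemma expands_polynomial:
  fixes U :: "real \<Rightarrow> real \<Rightarrow> real^'m"
  assumes "real_polynomial_function T" and U: "\<And>l. expands N (\<lambda>h c. U h c $ l)"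
  shows "expands N (\<lambda>h c. T (U h c))"
  using assms(1)
proof (induction rule: real_polynomial_function.induct)
  case (linear T)
  interpret bounded_linear T by fact
  have "T (U h c) = (\<Sum>l\<in>UNIV. T (axis l 1) * U h c $ l)" for h c
  proof -
    have "U h c = (\<Sum>l\<in>UNIV. U h c $ l *\<^sub>R axis l 1)"
      by (metis (no_types) basis_expansion scalar_mult_eq_scaleR)
    then have "T (U h c) = T (\<Sum>l\<in>UNIV. U h c $ l *\<^sub>R axis l 1)" by (rule arg_cong)
    then show ?thesis by (simp add: sum scaleR mult.commute)
  qed
  then show ?case
    by (auto intro!: expands_sum expands_mult expands_graded[OF graded_const] U)
qed (auto intro: expands_graded graded_const expands_add expands_mult)

text \<open>
  The operator \<open>h \<integral>\<^sub>0\<^sup>c\<close> gains one order, which drives the bootstrapping of the integral equations.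
\<close>
lemma expands_integral:
  assumes "\<forall>\<^sub>F h in at_right 0. continuous_on {0..1} (g h)" and "expands N g"
  shows "expands (Suc N) (\<lambda>h c. h * integral {0..c} (g h))"
proof -
  obtain G where G: "graded 0 G" "uniform_O N (\<lambda>h c. g h c - G h c)"
    using assms(2) unfolding expands_def by blast
  obtain H where H: "graded (Suc 0) H" "\<And>h c. c \<ge> 0 \<Longrightarrow> H h c = h * integral {0..c} (G h)"
    using graded_integral[OF G(1)] by blast
  have H0: "graded 0 H" using H(1)
    by (induction rule: graded.induct) (auto intro: graded.intros)
  have "uniform_O (Suc N) (\<lambda>h c. h * integral {0..c} (\<lambda>s. g h s - G h s))"
    by (intro uniform_O_h_times uniform_O_integral G)
  moreover have "\<forall>\<^sub>F h in at_right 0. \<forall>c\<in>{0..1}.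
      h * integral {0..c} (g h) - H h c = h * integral {0..c} (\<lambda>s. g h s - G h s)"
    using assms(1)
  proof eventually_elim
    case (elim h)
    have "g h integrable_on {0..c}" if "c \<le> 1" for c
      using that by (intro integrable_continuous_real continuous_on_subset[OF elim]) auto
    then show ?case
      using graded_continuous[OF G(1)] H(2)
      by (auto simp: integral_diff integrable_continuous_real right_diff_distrib)
  qed
  ultimately have "uniform_O (Suc N) (\<lambda>h c. h * integral {0..c} (g h) - H h c)" by (rule uniform_O_cong)
  then show ?thesis using H0 unfolding expands_def by blast
qed

section \<open>Projection onto polynomials of low degree\<close>

text \<open>
  Subtracting the multiple of \<open>P r\<close> with the same coefficient at \<open>r\<close> lowers the degree; the leading
  coefficient of \<open>P r\<close> does not vanish since \<open>P r\<close> has norm 1.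
\<close>
lemma orthonormal_legendre_span:
  assumes P: "orthonormal_legendre P" and "degree p < r"
  shows "\<exists>b. p = (\<Sum>j<r. smult (b j) (P j))"
  using assms(2)
proof (induction r arbitrary: p)
  case 0
  then show ?case by simp
next
  case (Suc r)
  have deg: "degree (P j) = j" for j using P by (simp add: orthonormal_legendre_def)
  have "P r \<noteq> 0"
  proof
    assume "P r = 0"
    moreover have "integral {0..1} (\<lambda>x. poly (P r) x * poly (P r) x) = 1"
      using P by (simp add: orthonormal_legendre_def)
    ultimately show False by simp
  qed
  then have lc: "coeff (P r) r \<noteq> 0" using deg[of r] leading_coeff_0_iff by metis
  define q where "q = p - smult (coeff p r / coeff (P r) r) (P r)"
  have q0: "coeff q k = 0" if "k \<ge> r" for k
  proof (cases "k = r")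
    case True
    then show ?thesis using lc by (simp add: q_def)
  next
    case False
    with that have "k > degree p" "k > degree (P r)" using Suc.prems deg by auto
    then show ?thesis by (simp add: q_def coeff_eq_0)
  qed
  have "\<exists>b. q = (\<Sum>j<r. smult (b j) (P j))"
  proof (cases "r = 0")
    case True
    then have "q = 0" using q0 by (intro poly_eqI) simp
    then show ?thesis using True by simp
  next
    case False
    have "degree q \<le> r - 1" using q0 False by (intro degree_le) auto
    then show ?thesis using False by (intro Suc.IH) auto
  qed
  then obtain b where b: "q = (\<Sum>j<r. smult (b j) (P j))" by blast
  show ?case
    using b by (intro exI[of _ "b(r := coeff p r / coeff (P r) r)"]) (simp add: q_def algebra_simps)
qed

text \<open>
  The \<open>L\<^sup>2\<close>-projection onto the polynomials of degree less than \<open>r\<close>, written through the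
  orthonormal basis.
\<close>
definition proj :: "(nat \<Rightarrow> real poly) \<Rightarrow> nat \<Rightarrow> (real \<Rightarrow> real) \<Rightarrow> real \<Rightarrow> real" where
  "proj P r u c = (\<Sum>j<r. poly (P j) c * integral {0..1} (\<lambda>\<tau>. poly (P j) \<tau> * u \<tau>))"

lemma integrable_poly_times:
  "continuous_on {0..1} u \<Longrightarrow> (\<lambda>\<tau>. poly p \<tau> * u \<tau>) integrable_on {0..1::real}" for u :: "real \<Rightarrow> real"
  by (intro integrable_continuous_real continuous_intros)

lemma proj_add:
  assumes "continuous_on {0..1} u" "continuous_on {0..1} v"
  shows "proj P r (\<lambda>c. u c + v c) c = proj P r u c + proj P r v c"
  unfolding proj_def using assms
  by (simp add: distrib_left integral_add integrable_poly_times sum.distrib)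

lemma proj_cmult: "proj P r (\<lambda>c. a * u c) c = a * proj P r u c"
  unfolding proj_def sum_distrib_left
  by (intro sum.cong refl) (simp add: mult.left_commute[of _ a])

lemma proj_diff:
  assumes "continuous_on {0..1} u" "continuous_on {0..1} v"
  shows "proj P r (\<lambda>c. u c - v c) c = proj P r u c - proj P r v c"
  unfolding proj_def using assms
  by (simp add: right_diff_distrib integral_diff integrable_poly_times sum_subtractf)

lemma continuous_on_proj: "continuous_on S (proj P r u)"
  unfolding proj_def by (intro continuous_intros)

lemma uniform_O_proj:
  assumes "uniform_O n g"
  shows "uniform_O n (\<lambda>h. proj P r (g h))"
proof -
  have "uniform_O 0 (\<lambda>h. poly (P j))" for j
    by (intro uniform_O_of_continuous continuous_intros)
  then have "uniform_O (0 + n) (\<lambda>h c. poly (P j) c * integral {0..1} (\<lambda>\<tau>. poly (P j) \<tau> * g h \<tau>))" for j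
    using assms by (intro uniform_O_mult uniform_O_integral_0_1) (use uniform_O_mult[of 0 _ n g] in simp)+
  then show ?thesis unfolding proj_def by (intro uniform_O_sum) simp
qed

lemma proj_poly:
  assumes P: "orthonormal_legendre P" and "degree p < r"
  shows "proj P r (poly p) c = poly p c"
proof -
  obtain b where b: "p = (\<Sum>j<r. smult (b j) (P j))"
    using orthonormal_legendre_span[OF assms] by blast
  have "integral {0..1} (\<lambda>\<tau>. poly (P j) \<tau> * poly p \<tau>) = b j" if "j < r" for j
  proof -
    have "integral {0..1} (\<lambda>\<tau>. poly (P j) \<tau> * poly p \<tau>)
        = integral {0..1} (\<lambda>\<tau>. \<Sum>i<r. b i * (poly (P j) \<tau> * poly (P i) \<tau>))"
      unfolding b by (simp add: poly_sum sum_distrib_left mult_ac)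
    also have "\<dots> = (\<Sum>i<r. integral {0..1} (\<lambda>\<tau>. b i * (poly (P j) \<tau> * poly (P i) \<tau>)))"
      by (intro integral_sum integrable_continuous_real continuous_intros) simp
    also have "\<dots> = (\<Sum>i<r. b i * (if j = i then 1 else 0))"
      using P by (simp add: orthonormal_legendre_def)
    also have "\<dots> = (\<Sum>i<r. if j = i then b i else 0)" by (intro sum.cong) auto
    also have "\<dots> = b j" using that by simp
    finally show ?thesis .
  qed
  then have "proj P r (poly p) c = (\<Sum>j<r. poly (P j) c * b j)" by (simp add: proj_def)
  also have "\<dots> = poly (\<Sum>j<r. smult (b j) (P j)) c" by (simp add: poly_sum mult.commute)
  finally have "proj P r (poly p) c = poly (\<Sum>j<r. smult (b j) (P j)) c" .
  then show ?thesis by (simp only: b[symmetric])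
qed

lemma integral_proj_symmetric:
  assumes "continuous_on {0..1} u" "continuous_on {0..1} v"
  shows "integral {0..1} (\<lambda>c. proj P r u c * v c)
    = (\<Sum>j<r. integral {0..1} (\<lambda>\<tau>. poly (P j) \<tau> * u \<tau>) * integral {0..1} (\<lambda>\<tau>. poly (P j) \<tau> * v \<tau>))"
proof -
  let ?I = "\<lambda>j w. integral {0..1} (\<lambda>\<tau>. poly (P j) \<tau> * w \<tau>)"
  have "integral {0..1} (\<lambda>c. proj P r u c * v c) = integral {0..1} (\<lambda>c. \<Sum>j<r. ?I j u * (poly (P j) c * v c))"
    by (simp add: proj_def sum_distrib_right sum_distrib_left mult_ac)
  also have "\<dots> = (\<Sum>j<r. integral {0..1} (\<lambda>c. ?I j u * (poly (P j) c * v c)))"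
    using assms by (intro integral_sum integrable_continuous_real continuous_intros) auto
  finally show ?thesis by simp
qed

lemma proj_residual_orthogonal:
  assumes P: "orthonormal_legendre P" and p: "degree p < r" and u: "continuous_on {0..1} u"
  shows "integral {0..1} (\<lambda>c. poly p c * (u c - proj P r u c)) = 0"
proof -
  have cp: "continuous_on {0..1} (poly p)" by (intro continuous_intros)
  have "integral {0..1} (\<lambda>c. poly p c * (u c - proj P r u c))
      = integral {0..1} (\<lambda>c. poly p c * u c) - integral {0..1} (\<lambda>c. poly p c * proj P r u c)"
    unfolding right_diff_distrib
    by (intro integral_diff integrable_poly_times u continuous_on_proj)
  also have "integral {0..1} (\<lambda>c. poly p c * u c) = integral {0..1} (\<lambda>c. proj P r (poly p) c * u c)"
    by (simp add: proj_poly[OF P p])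
  also have "\<dots> = integral {0..1} (\<lambda>c. proj P r u c * poly p c)"
    using integral_proj_symmetric[OF cp u, of P r] integral_proj_symmetric[OF u cp, of P r]
    by (simp add: mult.commute)
  finally show ?thesis by (simp add: mult.commute)
qed

text \<open>
  A monomial of degree below \<open>r\<close> in \<open>c\<close> is reproduced by the projection. In all others the degree,
  hence also the power of \<open>h\<close>, is at least \<open>r\<close>: so they are \<open>O(h ^ r)\<close>, and so are their projections,
  whose smaller degree in \<open>c\<close> respects the grading.
\<close>
lemma proj_graded:
  assumes P: "orthonormal_legendre P" and "graded n G"
  shows "\<exists>H. graded n H \<and> uniform_O r (\<lambda>h c. G h c - H h c) \<and> (\<forall>h. proj P r (G h) = H h)"
  using assms(2)
proof (induction rule: graded.induct)
  case (monom k j a)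
  have eq: "proj P r (\<lambda>c. a * h ^ k * c ^ j) c = a * h ^ k * proj P r (\<lambda>c. c ^ j) c" for h c
    by (rule proj_cmult)
  show ?case
  proof (cases "j < r")
    case True
    have "proj P r (\<lambda>c. c ^ j) c = c ^ j" for c
      using proj_poly[OF P, of "Polynomial.monom 1 j" r c] True
      by (simp add: poly_monom degree_monom_eq proj_def)
    then show ?thesis
      using graded.monom[OF monom, of a] by (intro exI[of _ "\<lambda>h c. a * h ^ k * c ^ j"]) (simp add: eq fun_eq_iff)
  next
    case False
    then have k: "r \<le> k" using monom by simp
    define q where "q = (\<Sum>l<r. smult (integral {0..1} (\<lambda>\<tau>. poly (P l) \<tau> * \<tau> ^ j)) (P l))"
    have q: "proj P r (\<lambda>c. c ^ j) c = poly q c" for c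
      by (simp add: proj_def q_def poly_sum mult.commute)
    have "degree (P l) = l" for l using P by (simp add: orthonormal_legendre_def)
    then have "degree q \<le> r"
      unfolding q_def by (intro degree_sum_le) (auto intro: order_trans[OF degree_smult_le])
    then have dq: "degree q \<le> k" using k by simp
    let ?H = "\<lambda>h c. \<Sum>i\<le>degree q. (a * coeff q i) * h ^ k * c ^ i"
    have H: "graded n ?H" "graded k ?H"
      using monom dq by (intro graded_sum graded.monom; simp)+
    have "proj P r (\<lambda>c. a * h ^ k * c ^ j) = ?H h" for h
      unfolding fun_eq_iff eq q by (simp add: poly_altdef sum_distrib_left mult_ac)
    moreover have "uniform_O r (\<lambda>h c. a * h ^ k * c ^ j - ?H h c)"
      using k monom by (intro uniform_O_diff uniform_O_mono[OF graded_uniform_O[of k] k] graded.monom H) auto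
    ultimately show ?thesis using H by blast
  qed
next
  case (add F G)
  then obtain HF HG where "graded n HF" "graded n HG"
      and u: "uniform_O r (\<lambda>h c. F h c - HF h c)" "uniform_O r (\<lambda>h c. G h c - HG h c)"
      and p: "\<And>h. proj P r (F h) = HF h" "\<And>h. proj P r (G h) = HG h" by blast
  then have "graded n (\<lambda>h c. HF h c + HG h c)" by (intro graded.add)
  moreover have "proj P r (\<lambda>c. F h c + G h c) = (\<lambda>c. HF h c + HG h c)" for h
    using proj_add[OF graded_continuous[OF add.hyps(1)] graded_continuous[OF add.hyps(2)]]
    by (simp add: p fun_eq_iff)
  moreover have "uniform_O r (\<lambda>h c. F h c + G h c - (HF h c + HG h c))"
    by (rule uniform_O_cong[OF uniform_O_add[OF u]]) simp
  ultimately show ?case by blast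
qed

lemma expands_proj:
  assumes P: "orthonormal_legendre P"
    and cont: "\<forall>\<^sub>F h in at_right 0. continuous_on {0..1} (g h)" and "expands N g"
  shows "expands N (\<lambda>h. proj P r (g h))"
proof -
  obtain G where G: "graded 0 G" "uniform_O N (\<lambda>h c. g h c - G h c)"
    using assms(3) unfolding expands_def by blast
  obtain H where H: "graded 0 H" "\<And>h. proj P r (G h) = H h"
    using proj_graded[OF P G(1)] by blast
  have "uniform_O N (\<lambda>h c. proj P r (g h) c - H h c)"
  proof (rule uniform_O_cong[OF uniform_O_proj[OF G(2)]])
    show "\<forall>\<^sub>F h in at_right 0. \<forall>c\<in>{0..1}.
      proj P r (g h) c - H h c = proj P r (\<lambda>c. g h c - G h c) c"
      using cont by eventually_elim (simp add: proj_diff graded_continuous[OF G(1)] H)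
  qed
  then show ?thesis using H(1) unfolding expands_def by blast
qed

lemma residual_uniform_O:
  assumes P: "orthonormal_legendre P"
    and cont: "\<forall>\<^sub>F h in at_right 0. continuous_on {0..1} (g h)" and "expands r g"
  shows "uniform_O r (\<lambda>h c. g h c - proj P r (g h) c)"
proof -
  obtain G where G: "graded 0 G" "uniform_O r (\<lambda>h c. g h c - G h c)"
    using assms(3) unfolding expands_def by blast
  obtain H where H: "graded 0 H" "uniform_O r (\<lambda>h c. G h c - H h c)" "\<And>h. proj P r (G h) = H h"
    using proj_graded[OF P G(1)] by blast
  have "uniform_O r (\<lambda>h c. (g h c - G h c) + (G h c - H h c) - proj P r (\<lambda>c. g h c - G h c) c)"
    by (intro uniform_O_add uniform_O_diff uniform_O_proj G H)
  then show ?thesis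
  proof (rule uniform_O_cong)
    show "\<forall>\<^sub>F h in at_right 0. \<forall>c\<in>{0..1}. g h c - proj P r (g h) c
       = (g h c - G h c) + (G h c - H h c) - proj P r (\<lambda>c. g h c - G h c) c"
      using cont by eventually_elim (simp add: proj_diff graded_continuous[OF G(1)] H)
  qed
qed

text \<open>
  This is where orthogonality acts: a monomial of degree below \<open>r\<close> in \<open>c\<close> gives zero, and any other one
  contributes a factor \<open>h ^ r\<close> on top of the residual.
\<close>
lemma residual_graded_integral:
  assumes P: "orthonormal_legendre P"
    and cont: "\<forall>\<^sub>F h in at_right 0. continuous_on {0..1} (g h)" and "expands r g"
    and "graded n G"
  shows "uniform_O (2 * r) (\<lambda>h c. integral {0..1} (\<lambda>s. G h s * (g h s - proj P r (g h) s)))"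
  using assms(4)
proof (induction rule: graded.induct)
  case (monom k j a)
  show ?case
  proof (cases "j < r")
    case True
    have "\<forall>\<^sub>F h in at_right 0. \<forall>c\<in>{0..1::real}.
        integral {0..1} (\<lambda>s. a * h ^ k * s ^ j * (g h s - proj P r (g h) s)) = 0"
      using cont
    proof eventually_elim
      case (elim h)
      have "integral {0..1} (\<lambda>s. s ^ j * (g h s - proj P r (g h) s)) = 0"
        using proj_residual_orthogonal[OF P _ elim, of "Polynomial.monom 1 j" r] True
        by (simp add: poly_monom degree_monom_eq)
      then show ?case by (simp add: mult.assoc)
    qed
    then show ?thesis by (rule uniform_O_cong[OF uniform_O_0])
  next
    case False
    have "uniform_O r (\<lambda>h c. a * h ^ k * c ^ j)"
      using False monom by (intro graded_uniform_O graded.monom) auto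
    from uniform_O_mult[OF this residual_uniform_O[OF assms(1-3)]] show ?thesis
      by (intro uniform_O_integral_0_1) (simp add: mult_2)
  qed
next
  case (add F G)
  show ?case
  proof (rule uniform_O_cong[OF uniform_O_add[OF add.IH]])
    show "\<forall>\<^sub>F h in at_right 0. \<forall>c\<in>{0..1::real}.
        integral {0..1} (\<lambda>s. (F h s + G h s) * (g h s - proj P r (g h) s)) =
        integral {0..1} (\<lambda>s. F h s * (g h s - proj P r (g h) s)) +
        integral {0..1} (\<lambda>s. G h s * (g h s - proj P r (g h) s))"
      using cont
    proof eventually_elim
      case (elim h)
      show ?case unfolding distrib_right
        by (intro ballI integral_add integrable_continuous_real continuous_intros elim continuous_on_proj
           graded_continuous[OF add.hyps(1)] graded_continuous[OF add.hyps(2)])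
    qed
  qed
qed

section \<open>Solutions of integral equations have graded expansions\<close>

text \<open>
  With \<open>U = y0 + O(h ^ k)\<close>, a Taylor remainder of order \<open>N\<close> at \<open>y0\<close> is \<open>O(h ^ (N k))\<close>; only \<open>k = 0\<close>
  (mere boundedness) and \<open>k = 1\<close> occur.
\<close>
lemma taylor_remainder_uniform_O:
  fixes U :: "real \<Rightarrow> real \<Rightarrow> real^'m"
  assumes near: "\<forall>\<^sub>F h in at_right 0. \<forall>c\<in>{0..1}. U h c \<in> S"
    and U: "\<And>l. uniform_O k (\<lambda>h c. (U h c - y0) $ l)"
    and T: "\<And>z. z \<in> S \<Longrightarrow> \<bar>g z - T z\<bar> \<le> C * norm (z - y0) ^ N"
  shows "uniform_O (N * k) (\<lambda>h c. g (U h c) - T (U h c))"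
proof (rule uniform_O_le)
  have "uniform_O (0 + N * k) (\<lambda>h c. C * norm (U h c - y0) ^ N)"
    by (intro uniform_O_mult uniform_O_power uniform_O_norm_components U uniform_O_of_continuous continuous_intros)
  then show "uniform_O (N * k) (\<lambda>h c. C * norm (U h c - y0) ^ N)" by simp
  show "\<forall>\<^sub>F h in at_right 0. \<forall>c\<in>{0..1}. \<bar>g (U h c) - T (U h c)\<bar> \<le> \<bar>C * norm (U h c - y0) ^ N\<bar>"
    using near by eventually_elim (meson T abs_ge_self order_trans)
qed

text \<open>
  Bootstrapping. Boundedness of \<open>U\<close> gives an expansion of order 0, hence \<open>U - y0 = O(h)\<close>. Then
  an expansion of order \<open>N\<close> of \<open>U\<close> passes to \<open>f(U)\<close> via the Taylor polynomial, to \<open>V\<close> by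
  assumption, and returns through the integral equation as one of order \<open>N + 1\<close> of \<open>U\<close>. The hypothesis on \<open>V\<close>
  covers both the exact problem, \<open>V = f(U)\<close>, and the truncated one, \<open>V = \<Pi> f(U)\<close>.
\<close>
lemma integral_equation_expands:
  fixes U :: "real \<Rightarrow> real \<Rightarrow> real^'m" and f :: "real^'m \<Rightarrow> real^'m"
  assumes taylor: "\<And>N i. \<exists>T. real_polynomial_function T \<and>
       (\<exists>C. \<forall>z\<in>cball y0 d. \<bar>f z $ i - T z\<bar> \<le> C * norm (z - y0) ^ N)"
    and near: "\<forall>\<^sub>F h in at_right 0. \<forall>c\<in>{0..1}. U h c \<in> cball y0 d"
    and U: "\<And>i. \<forall>\<^sub>F h in at_right 0. \<forall>c\<in>{0..1}. U h c $ i = y0 $ i + h * integral {0..c} (V i h)"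
    and cont: "\<And>i. \<forall>\<^sub>F h in at_right 0. continuous_on {0..1} (V i h)"
    and V: "\<And>i N. expands N (\<lambda>h c. f (U h c) $ i) \<Longrightarrow> expands N (V i)"
  shows "uniform_O 1 (\<lambda>h c. (U h c - y0) $ i)" and "expands N (\<lambda>h c. U h c $ i)"
    and "expands N (\<lambda>h c. f (U h c) $ i)"
proof -
  have uniform_O_0: "uniform_O 0 (\<lambda>h c. (U h c - y0) $ l)" for l
  proof (rule uniform_O_I)
    show "\<forall>\<^sub>F h in at_right 0. \<forall>c\<in>{0..1}. \<bar>(U h c - y0) $ l\<bar> \<le> d * h ^ 0"
      using near
    proof eventually_elim
      case (elim h)
      show ?case
      proof
        fix c :: real assume "c \<in> {0..1}"
        then have "norm (U h c - y0) \<le> d" using elim by (auto simp: dist_norm norm_minus_commute)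
        then show "\<bar>(U h c - y0) $ l\<bar> \<le> d * h ^ 0"
          using component_le_norm_cart[of "U h c - y0" l] by simp
      qed
    qed
  qed
  have compose: "expands N (\<lambda>h c. f (U h c) $ i)"
    if U1: "\<And>l. uniform_O k (\<lambda>h c. (U h c - y0) $ l)" and Nk: "N \<le> N * k"
      and UN: "\<And>l. expands N (\<lambda>h c. U h c $ l)" for N k i
  proof -
    obtain T C where T: "real_polynomial_function T"
      "\<And>z. z \<in> cball y0 d \<Longrightarrow> \<bar>f z $ i - T z\<bar> \<le> C * norm (z - y0) ^ N"
      using taylor[of i N] by blast
    have "uniform_O (N * k) (\<lambda>h c. f (U h c) $ i - T (U h c))"
      by (rule taylor_remainder_uniform_O[OF near U1 T(2)])
    then have "uniform_O N (\<lambda>h c. f (U h c) $ i - T (U h c))" using Nk by (rule uniform_O_mono)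
    then show ?thesis using expands_polynomial[OF T(1) UN] by (rule expands_uniform_O)
  qed
  have step: "expands (Suc N) (\<lambda>h c. U h c $ i)" if "expands N (\<lambda>h c. f (U h c) $ i)" for N i
    using expands_add[OF expands_graded[OF graded_const] expands_integral[OF cont V[OF that]]] U[of i]
    by (rule expands_cong)
  have U0: "expands 0 (\<lambda>h c. U h c $ l)" for l
    by (rule expands_uniform_O[OF _ expands_graded[OF graded_const[of "y0 $ l"]]]) (use uniform_O_0[of l] in simp)
  have f0: "expands 0 (\<lambda>h c. f (U h c) $ i)" for i
    using compose[of 0 0] uniform_O_0 U0 by simp
  show uniform_O_1: "uniform_O 1 (\<lambda>h c. (U h c - y0) $ i)" for i
  proof (rule uniform_O_cong)
    show "uniform_O 1 (\<lambda>h c. h * integral {0..c} (V i h))"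
      using uniform_O_h_times[OF uniform_O_integral[OF expands_uniform_O_0[OF V[OF f0]]]] by simp
    show "\<forall>\<^sub>F h in at_right 0. \<forall>c\<in>{0..1}. (U h c - y0) $ i = h * integral {0..c} (V i h)"
      using U[of i] by eventually_elim simp
  qed
  have all: "\<forall>l. expands N (\<lambda>h c. U h c $ l)" for N
  proof (induction N)
    case (Suc N)
    then show ?case using step compose[of 1 N] uniform_O_1 by simp
  qed (use U0 in blast)
  then show "expands N (\<lambda>h c. U h c $ i)" by blast
  show "expands N (\<lambda>h c. f (U h c) $ i)" using compose[of 1 N] uniform_O_1 all by simp
qed

section \<open>Order doubling\<close>

text \<open>
  A polynomial analogue of the mean value theorem. The coefficients, which replace the averaged
  Jacobian, arise from the product rule \<open>F G - F' G' = F (G - G') + G' (F - F')\<close>, the primes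
  marking values at \<open>W\<close>, and are graded because polynomials in \<open>Y\<close> and \<open>W\<close> have graded expansions. Replacing those values by their expansions costs
  \<open>O(h ^ N)\<close> times the difference \<open>O(h ^ M)\<close>.
\<close>
lemma polynomial_difference:
  fixes Y W :: "real \<Rightarrow> real \<Rightarrow> real^'m"
  assumes "real_polynomial_function T"
    and Y: "\<And>l. expands N (\<lambda>h c. Y h c $ l)" and W: "\<And>l. expands N (\<lambda>h c. W h c $ l)"
    and e: "\<And>l. uniform_O M (\<lambda>h c. Y h c $ l - W h c $ l)"
  shows "\<exists>A. (\<forall>l. graded 0 (A l)) \<and>
    uniform_O (N + M) (\<lambda>h c. T (Y h c) - T (W h c) - (\<Sum>l\<in>UNIV. A l h c * (Y h c $ l - W h c $ l)))"
  using assms(1)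
proof (induction rule: real_polynomial_function.induct)
  case (linear T)
  interpret bounded_linear T by fact
  have "T (Y h c) - T (W h c) = (\<Sum>l\<in>UNIV. T (axis l 1) * (Y h c $ l - W h c $ l))" for h c
  proof -
    have "Y h c - W h c = (\<Sum>l\<in>UNIV. (Y h c - W h c) $ l *\<^sub>R axis l 1)"
      by (metis (no_types) basis_expansion scalar_mult_eq_scaleR)
    then have "T (Y h c - W h c) = T (\<Sum>l\<in>UNIV. (Y h c - W h c) $ l *\<^sub>R axis l 1)" by (rule arg_cong)
    then show ?thesis by (simp only: sum scaleR diff vector_minus_component real_scaleR_def mult.commute)
  qed
  then show ?case
    by (intro exI[of _ "\<lambda>l h c. T (axis l 1)"]) (simp add: graded_const)
next
  case (const k)
  show ?case by (intro exI[of _ "\<lambda>l h c. 0"]) (simp add: graded_0)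
next
  case (add F G)
  then obtain A B where "\<And>l. graded 0 (A l)" "\<And>l. graded 0 (B l)"
    and u: "uniform_O (N + M) (\<lambda>h c. F (Y h c) - F (W h c) - (\<Sum>l\<in>UNIV. A l h c * (Y h c $ l - W h c $ l)))"
      "uniform_O (N + M) (\<lambda>h c. G (Y h c) - G (W h c) - (\<Sum>l\<in>UNIV. B l h c * (Y h c $ l - W h c $ l)))"
    by blast
  then have "\<forall>l. graded 0 (\<lambda>h c. A l h c + B l h c)" by (auto intro: graded.add)
  moreover have "uniform_O (N + M) (\<lambda>h c. F (Y h c) + G (Y h c) - (F (W h c) + G (W h c))
      - (\<Sum>l\<in>UNIV. (A l h c + B l h c) * (Y h c $ l - W h c $ l)))"
    by (rule uniform_O_cong[OF uniform_O_add[OF u]]) (simp add: distrib_right sum.distrib)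
  ultimately show ?case by (intro exI[of _ "\<lambda>l h c. A l h c + B l h c"]) blast
next
  case (mult F G)
  let ?e = "\<lambda>l h c. Y h c $ l - W h c $ l"
  obtain A B where A: "\<And>l. graded 0 (A l)" and B: "\<And>l. graded 0 (B l)"
    and uA: "uniform_O (N + M) (\<lambda>h c. F (Y h c) - F (W h c) - (\<Sum>l\<in>UNIV. A l h c * ?e l h c))"
    and uB: "uniform_O (N + M) (\<lambda>h c. G (Y h c) - G (W h c) - (\<Sum>l\<in>UNIV. B l h c * ?e l h c))"
    using mult.IH by blast
  have FY: "expands N (\<lambda>h c. F (Y h c))" and GW: "expands N (\<lambda>h c. G (W h c))"
    using mult.hyps Y W by (auto intro: expands_polynomial)
  obtain F' where F': "graded 0 F'" "uniform_O N (\<lambda>h c. F (Y h c) - F' h c)"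
    using FY unfolding expands_def by blast
  obtain G' where G': "graded 0 G'" "uniform_O N (\<lambda>h c. G (W h c) - G' h c)"
    using GW unfolding expands_def by blast
  have sums: "uniform_O M (\<lambda>h c. \<Sum>l\<in>UNIV. K l h c * ?e l h c)" if "\<And>l. graded 0 (K l)" for K
    using uniform_O_mult[OF graded_uniform_O[OF that] e] by (intro uniform_O_sum) simp
  have "uniform_O (N + M) (\<lambda>h c.
      F (Y h c) * (G (Y h c) - G (W h c) - (\<Sum>l\<in>UNIV. B l h c * ?e l h c))
      + G (W h c) * (F (Y h c) - F (W h c) - (\<Sum>l\<in>UNIV. A l h c * ?e l h c))
      + (F (Y h c) - F' h c) * (\<Sum>l\<in>UNIV. B l h c * ?e l h c)
      + (G (W h c) - G' h c) * (\<Sum>l\<in>UNIV. A l h c * ?e l h c))"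
    using uniform_O_mult[OF expands_uniform_O_0[OF FY] uB] uniform_O_mult[OF expands_uniform_O_0[OF GW] uA]
      uniform_O_mult[OF F'(2) sums[OF B]] uniform_O_mult[OF G'(2) sums[OF A]]
    by (intro uniform_O_add) simp_all
  moreover have "(\<Sum>l\<in>UNIV. (F' h c * B l h c + G' h c * A l h c) * ?e l h c)
      = F' h c * (\<Sum>l\<in>UNIV. B l h c * ?e l h c) + G' h c * (\<Sum>l\<in>UNIV. A l h c * ?e l h c)" for h c
    by (simp add: distrib_right sum.distrib sum_distrib_left mult.assoc)
  ultimately have "uniform_O (N + M) (\<lambda>h c. F (Y h c) * G (Y h c) - F (W h c) * G (W h c)
      - (\<Sum>l\<in>UNIV. (F' h c * B l h c + G' h c * A l h c) * ?e l h c))"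
    by (simp add: algebra_simps)
  moreover have "graded 0 (\<lambda>h c. F' h c * B l h c + G' h c * A l h c)" for l
    using graded_mult[OF F'(1) B] graded_mult[OF G'(1) A] by (intro graded.add) simp_all
  ultimately show ?case by (intro exI[of _ "\<lambda>l h c. F' h c * B l h c + G' h c * A l h c"]) blast
qed

text \<open>
  Applied with \<open>H = h \<integral>\<^sub>c\<^sup>1 G\<close>: both boundary terms vanish, since \<open>H\<close> is zero at 1 and \<open>e\<close> is zero at 0.
\<close>
lemma integral_parts_from_zero:
  fixes k H :: "real \<Rightarrow> real"
  assumes k: "continuous_on {0..1} k" and H: "\<And>c. (H has_vector_derivative - h * G c) (at c)"
    and H1: "H 1 = 0" and e: "\<And>c. c \<in> {0..1} \<Longrightarrow> e c = h * integral {0..c} k" and h: "h > 0"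
    and G: "continuous_on {0..1} G"
  shows "integral {0..1} (\<lambda>c. G c * e c) = integral {0..1} (\<lambda>c. H c * k c)"
proof -
  let ?K = "\<lambda>c. integral {0..c} k"
  have K: "(?K has_vector_derivative k c) (at c within {0..1})" if "c \<in> {0..1}" for c
    using that k by (intro integral_has_vector_derivative)
  have "((\<lambda>c. H c * ?K c) has_vector_derivative (H c * k c + (- h * G c) * ?K c)) (at c within {0..1})"
    if "c \<in> {0..1}" for c
    using has_vector_derivative_mult[OF has_vector_derivative_at_within[OF H] K[OF that]] by simp
  then have i: "((\<lambda>c. H c * k c + (- h * G c) * ?K c) has_integral H 1 * ?K 1 - H 0 * ?K 0) {0..1}"
    by (intro fundamental_theorem_of_calculus) auto
  have cH: "continuous_on {0..1} H"
    using H by (intro continuous_on_vector_derivative) (auto intro: has_vector_derivative_at_within)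
  have cK: "continuous_on {0..1} ?K"
    using K by (rule continuous_on_vector_derivative)
  have "integral {0..1} (\<lambda>c. H c * k c + (- h * G c) * ?K c) = 0"
    using integral_unique[OF i] H1 by simp
  moreover have "integral {0..1} (\<lambda>c. H c * k c + (- h * G c) * ?K c)
      = integral {0..1} (\<lambda>c. H c * k c) + integral {0..1} (\<lambda>c. (- h * G c) * ?K c)"
    by (intro integral_add integrable_continuous_real continuous_intros cH cK k G)
  moreover have "integral {0..1} (\<lambda>c. (- h * G c) * ?K c) = - integral {0..1} (\<lambda>c. G c * e c)"
    unfolding integral_neg[symmetric] by (intro integral_cong) (simp add: e)
  ultimately show ?thesis by simp
qed

text \<open>
  The order doubling for a linear integral equation \<open>e = h \<integral>\<^sub>0\<^sup>c (A e + R + \<rho>)\<close> in which \<open>R\<close> has small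
  moments against graded functions. All moments of \<open>e\<close> against graded functions of order \<open>n\<close> are
  \<open>O(h ^ (2 r))\<close>, by induction on \<open>r - 1 - n\<close>; the last step gains one more power of \<open>h\<close>.
\<close>
lemma superconvergence:
  fixes e k R \<rho> :: "'m::finite \<Rightarrow> real \<Rightarrow> real \<Rightarrow> real" and A :: "'m \<Rightarrow> 'm \<Rightarrow> real \<Rightarrow> real \<Rightarrow> real"
  assumes r: "r \<ge> 1"
    and e: "\<And>i. \<forall>\<^sub>F h in at_right 0. \<forall>c\<in>{0..1}. e i h c = h * integral {0..c} (k i h)"
    and k: "\<And>i. \<forall>\<^sub>F h in at_right 0. \<forall>c\<in>{0..1}. k i h c = (\<Sum>l\<in>UNIV. A i l h c * e l h c) + R i h c + \<rho> i h c"
    and cont: "\<And>i. \<forall>\<^sub>F h in at_right 0. continuous_on {0..1} (k i h)"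
      "\<And>i. \<forall>\<^sub>F h in at_right 0. continuous_on {0..1} (R i h)"
    and A: "\<And>i l. graded 0 (A i l)"
    and uniform_O_e: "\<And>i. uniform_O (Suc r) (e i)" and uniform_O_\<rho>: "\<And>i. uniform_O (2 * r) (\<rho> i)"
    and R: "\<And>i G. graded 0 G \<Longrightarrow> uniform_O (2 * r) (\<lambda>h c. integral {0..1} (\<lambda>s. G h s * R i h s))"
  shows "uniform_O (Suc (2 * r)) (\<lambda>h c. e i h 1)"
proof -
  have cont_e: "\<forall>\<^sub>F h in at_right 0. continuous_on {0..1} (e i h)" for i
    using cont(1)[of i] e[of i]
  proof eventually_elim
    case (elim h)
    have "continuous_on {0..1} (\<lambda>c. h * integral {0..c} (k i h))"
      by (intro continuous_intros indefinite_integral_continuous_1 integrable_continuous_real elim)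
    then show ?case by (rule continuous_on_eq) (use elim in simp)
  qed
  have cont_e_all: "\<forall>\<^sub>F h in at_right 0. \<forall>l. continuous_on {0..1} (e l h)"
    by (rule eventually_all_finite) (rule cont_e)
  have split: "\<forall>\<^sub>F h in at_right 0. \<forall>c\<in>{0..1::real}. integral {0..1} (\<lambda>s. H h s * k i h s)
      = (\<Sum>l\<in>UNIV. integral {0..1} (\<lambda>s. (H h s * A i l h s) * e l h s))
        + integral {0..1} (\<lambda>s. H h s * R i h s) + integral {0..1} (\<lambda>s. H h s * \<rho> i h s)"
    if H: "graded n H" for n H i
    using k[of i] cont(1)[of i] cont(2)[of i] cont_e_all
  proof eventually_elim
    case (elim h)
    note cH = graded_continuous[OF H] and cA = graded_continuous[OF A]
    have c\<rho>: "continuous_on {0..1} (\<rho> i h)"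
    proof (rule continuous_on_eq)
      show "continuous_on {0..1} (\<lambda>c. k i h c - (\<Sum>l\<in>UNIV. A i l h c * e l h c) - R i h c)"
        using elim by (intro continuous_intros cA) auto
    qed (use elim in simp)
    have int: "(\<lambda>s. (H h s * A i l h s) * e l h s) integrable_on {0..1}" for l
      using elim by (intro integrable_continuous_real continuous_intros cH cA) auto
    have intR: "(\<lambda>s. H h s * R i h s) integrable_on {0..1}"
      and int\<rho>: "(\<lambda>s. H h s * \<rho> i h s) integrable_on {0..1}"
      using elim by (auto intro!: integrable_continuous_real continuous_intros cH c\<rho>)
    have "integral {0..1} (\<lambda>s. H h s * k i h s) = integral {0..1} (\<lambda>s.
        (\<Sum>l\<in>UNIV. (H h s * A i l h s) * e l h s) + H h s * R i h s + H h s * \<rho> i h s)"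
      using elim by (intro integral_cong) (simp add: algebra_simps sum_distrib_left)
    also have "\<dots> = (\<Sum>l\<in>UNIV. integral {0..1} (\<lambda>s. (H h s * A i l h s) * e l h s))
        + integral {0..1} (\<lambda>s. H h s * R i h s) + integral {0..1} (\<lambda>s. H h s * \<rho> i h s)"
      by (simp add: integral_add integrable_add integrable_sum int intR int\<rho> integral_sum)
    finally show ?case by simp
  qed
  have drop_\<rho>: "uniform_O (2 * r) (\<lambda>h c. integral {0..1} (\<lambda>s. H h s * \<rho> i h s))" if "graded 0 H" for H i
    using uniform_O_mult[OF graded_uniform_O[OF that] uniform_O_\<rho>] by (intro uniform_O_integral_0_1) simp
  have weaken: "graded 0 H" if "graded n H" for n H
    using that by (induction rule: graded.induct) (auto intro: graded.intros)
  have claim: "uniform_O (2 * r) (\<lambda>h c. integral {0..1} (\<lambda>s. G h s * e i h s))"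
    if "graded n G" "d = r - 1 - n" for n d G i
    using that
  proof (induction d arbitrary: n G i)
    case 0
    have "uniform_O (n + Suc r) (\<lambda>h c. integral {0..1} (\<lambda>s. G h s * e i h s))"
      by (intro uniform_O_integral_0_1 uniform_O_mult graded_uniform_O[OF 0(1)] uniform_O_e)
    \<comment> \<open>Here \<open>n \<ge> r - 1\<close>, so \<open>n + Suc r \<ge> 2 * r\<close>.\<close>
    then show ?case using 0(2) r by (rule_tac uniform_O_mono) auto
  next
    case (Suc d)
    obtain H where H: "graded (Suc n) H" "\<And>h. H h 1 = 0"
      "\<And>h c. (H h has_vector_derivative - h * G h c) (at c)"
      using graded_tail_integral[OF Suc.prems(1)] by blast
    have "uniform_O (2 * r) (\<lambda>h c. integral {0..1} (\<lambda>s. (H h s * A i l h s) * e l h s))" for l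
      using graded_mult[OF H(1) A] Suc.prems(2) by (intro Suc.IH[of "Suc n"]) auto
    then have "uniform_O (2 * r) (\<lambda>h c. (\<Sum>l\<in>UNIV. integral {0..1} (\<lambda>s. (H h s * A i l h s) * e l h s))
        + integral {0..1} (\<lambda>s. H h s * R i h s) + integral {0..1} (\<lambda>s. H h s * \<rho> i h s))"
      by (intro uniform_O_add uniform_O_sum R drop_\<rho> weaken[OF H(1)])
    then have u: "uniform_O (2 * r) (\<lambda>h c. integral {0..1} (\<lambda>s. H h s * k i h s))"
      using split[OF H(1)] by (rule uniform_O_cong)
    show ?case
    proof (rule uniform_O_cong[OF u])
      show "\<forall>\<^sub>F h in at_right 0. \<forall>c\<in>{0..1::real}.
          integral {0..1} (\<lambda>s. G h s * e i h s) = integral {0..1} (\<lambda>s. H h s * k i h s)"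
        using e[of i] cont(1)[of i] at_right_0_less[of 1, simplified]
      proof eventually_elim
        case (elim h)
        then show ?case
          using integral_parts_from_zero[OF elim(2) H(3) H(2) _ _ graded_continuous[OF Suc.prems(1)], of "e i h"]
          by simp
      qed
    qed
  qed
  \<comment> \<open>The weight 1 is a graded function, so the decomposition of moments applies to the integral of \<open>k\<close> itself.\<close>
  have "uniform_O (2 * r) (\<lambda>h c. (\<Sum>l\<in>UNIV. integral {0..1} (\<lambda>s. (1 * A i l h s) * e l h s))
        + integral {0..1} (\<lambda>s. 1 * R i h s) + integral {0..1} (\<lambda>s. 1 * \<rho> i h s))"
    using claim[OF A] by (intro uniform_O_add uniform_O_sum R drop_\<rho> graded_const) simp
  then have "uniform_O (2 * r) (\<lambda>h c. integral {0..1} (\<lambda>s. 1 * k i h s))"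
    using split[OF graded_const] by (rule uniform_O_cong)
  from uniform_O_h_times[OF this] show ?thesis
    by (rule uniform_O_cong) (use e[of i] in eventually_elim, simp)
qed

text \<open>
  A first bootstrapping through the Lipschitz bound yields \<open>Y - W = O(h ^ (r + 1))\<close>, the order of the
  residual limiting the gain. This a priori bound makes the linearization error \<open>O(h ^ (2 r + 1))\<close> and
  starts the order doubling.
\<close>
lemma truncation_error:
  fixes Y W :: "real \<Rightarrow> real \<Rightarrow> real^'m" and f :: "real^'m \<Rightarrow> real^'m"
  assumes P: "orthonormal_legendre P" and r: "r \<ge> 1" and L: "L \<ge> 0"
    and taylor: "\<And>N i. \<exists>T. real_polynomial_function T \<and>
       (\<exists>C. \<forall>z\<in>cball y0 d. \<bar>f z $ i - T z\<bar> \<le> C * norm (z - y0) ^ N)"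
    and lip: "\<And>z w i. z \<in> cball y0 d \<Longrightarrow> w \<in> cball y0 d \<Longrightarrow> \<bar>f z $ i - f w $ i\<bar> \<le> L * norm (z - w)"
    and near: "\<forall>\<^sub>F h in at_right 0. \<forall>c\<in>{0..1}. Y h c \<in> cball y0 d"
      "\<forall>\<^sub>F h in at_right 0. \<forall>c\<in>{0..1}. W h c \<in> cball y0 d"
    and Y: "\<And>i. \<forall>\<^sub>F h in at_right 0. \<forall>c\<in>{0..1}.
       Y h c $ i = y0 $ i + h * integral {0..c} (\<lambda>s. f (Y h s) $ i)"
    and W: "\<And>i. \<forall>\<^sub>F h in at_right 0. \<forall>c\<in>{0..1}.
       W h c $ i = y0 $ i + h * integral {0..c} (proj P r (\<lambda>s. f (W h s) $ i))"
    and cont: "\<And>i. \<forall>\<^sub>F h in at_right 0. continuous_on {0..1} (\<lambda>s. f (Y h s) $ i)"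
      "\<And>i. \<forall>\<^sub>F h in at_right 0. continuous_on {0..1} (\<lambda>s. f (W h s) $ i)"
  shows "uniform_O (Suc (2 * r)) (\<lambda>h c. (Y h 1 - W h 1) $ i)"
proof -
  note Y_exp = integral_equation_expands[OF taylor near(1) Y cont(1)]
  note W_exp = integral_equation_expands[OF taylor near(2) W _ expands_proj[OF P cont(2)],
      OF always_eventually[OF allI[OF continuous_on_proj]]]
  define e where "e i h c = Y h c $ i - W h c $ i" for i h c
  define R where "R i h c = f (W h c) $ i - proj P r (\<lambda>s. f (W h s) $ i) c" for i h c
  define k where "k i h c = f (Y h c) $ i - proj P r (\<lambda>s. f (W h s) $ i) c" for i h c
  have uniform_O_R: "uniform_O r (R i)" for i
    unfolding R_def by (rule residual_uniform_O[OF P cont(2) W_exp(3)])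
  have cont_k: "\<forall>\<^sub>F h in at_right 0. continuous_on {0..1} (k i h)" for i
    using cont(1)[of i] by eventually_elim (auto simp: k_def intro!: continuous_intros continuous_on_proj)
  have cont_R: "\<forall>\<^sub>F h in at_right 0. continuous_on {0..1} (R i h)" for i
    using cont(2)[of i] by eventually_elim (auto simp: R_def intro!: continuous_intros continuous_on_proj)
  have e: "\<forall>\<^sub>F h in at_right 0. \<forall>c\<in>{0..1}. e i h c = h * integral {0..c} (k i h)" for i
    using Y[of i] W[of i] cont(1)[of i]
  proof eventually_elim
    case (elim h)
    have "(\<lambda>s. f (Y h s) $ i) integrable_on {0..c}" if "c \<le> 1" for c
      using that by (intro integrable_continuous_real continuous_on_subset[OF elim(3)]) auto
    then show ?case
      using elim by (auto simp: e_def k_def[abs_def] integral_diff integrable_continuous_real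
          continuous_on_proj right_diff_distrib)
  qed
  have uniform_O_e: "n \<le> Suc r \<Longrightarrow> \<forall>i. uniform_O n (e i)" for n
  proof (induction n)
    case 0
    have "uniform_O 0 (\<lambda>h c. Y h c $ i - W h c $ i)" for i
      by (intro uniform_O_diff expands_uniform_O_0[OF Y_exp(2)] expands_uniform_O_0[OF W_exp(2)])
    then show ?case by (simp add: e_def[abs_def])
  next
    case (Suc n)
    have "uniform_O n (\<lambda>h c. norm (Y h c - W h c))"
      using Suc by (intro uniform_O_norm_components) (simp add: e_def[abs_def])
    then have "uniform_O (0 + n) (\<lambda>h c. L * norm (Y h c - W h c))"
      by (intro uniform_O_mult uniform_O_of_continuous continuous_intros)
    then have *: "uniform_O n (\<lambda>h c. L * norm (Y h c - W h c))" by simp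
    have diff: "uniform_O n (\<lambda>h c. f (Y h c) $ i - f (W h c) $ i)" for i
      by (rule uniform_O_le[OF *], use near in eventually_elim) (meson lip abs_ge_self order_trans)
    have "uniform_O n (k i)" for i
      using uniform_O_add[OF diff[of i] uniform_O_mono[OF uniform_O_R[of i], of n]] Suc.prems by (simp add: k_def[abs_def] R_def[abs_def])
    then have "uniform_O (Suc n) (e i)" for i
      using uniform_O_cong[OF uniform_O_h_times[OF uniform_O_integral] e] by blast
    then show ?case by blast
  qed
  have "\<forall>i. \<exists>A. (\<forall>l. graded 0 (A l)) \<and>
    uniform_O (2 * r) (\<lambda>h c. f (Y h c) $ i - f (W h c) $ i - (\<Sum>l\<in>UNIV. A l h c * e l h c))"
  proof
    fix i
    obtain T C where T: "real_polynomial_function T"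
      "\<And>z. z \<in> cball y0 d \<Longrightarrow> \<bar>f z $ i - T z\<bar> \<le> C * norm (z - y0) ^ (2 * r)"
      using taylor[of i "2 * r"] by blast
    have "uniform_O (Suc r) (\<lambda>h c. Y h c $ l - W h c $ l)" for l
      using uniform_O_e[of "Suc r"] by (simp add: e_def[abs_def])
    from polynomial_difference[OF T(1) Y_exp(2)[of r] W_exp(2)[of r] this]
    obtain A where A: "\<forall>l. graded 0 (A l)"
      "uniform_O (r + Suc r) (\<lambda>h c. T (Y h c) - T (W h c) - (\<Sum>l\<in>UNIV. A l h c * e l h c))"
      by (auto simp: e_def)
    have "uniform_O (2 * r * 1) (\<lambda>h c. f (Y h c) $ i - T (Y h c))"
      by (rule taylor_remainder_uniform_O[OF near(1) Y_exp(1) T(2)])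
    moreover have "uniform_O (2 * r * 1) (\<lambda>h c. f (W h c) $ i - T (W h c))"
      by (rule taylor_remainder_uniform_O[OF near(2) W_exp(1) T(2)])
    ultimately have "uniform_O (2 * r * 1) (\<lambda>h c. f (Y h c) $ i - T (Y h c) - (f (W h c) $ i - T (W h c)))"
      by (rule uniform_O_diff)
    then have "uniform_O (2 * r) (\<lambda>h c. f (Y h c) $ i - T (Y h c) - (f (W h c) $ i - T (W h c)))"
      by simp
    from uniform_O_add[OF this uniform_O_mono[OF A(2)]]
    have "uniform_O (2 * r) (\<lambda>h c. f (Y h c) $ i - f (W h c) $ i - (\<Sum>l\<in>UNIV. A l h c * e l h c))"
      by (simp add: algebra_simps)
    then show "\<exists>A. (\<forall>l. graded 0 (A l)) \<and>
        uniform_O (2 * r) (\<lambda>h c. f (Y h c) $ i - f (W h c) $ i - (\<Sum>l\<in>UNIV. A l h c * e l h c))"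
      using A(1) by blast
  qed
  from choice[OF this] obtain A where A: "\<And>i l. graded 0 (A i l)"
    "\<And>i. uniform_O (2 * r) (\<lambda>h c. f (Y h c) $ i - f (W h c) $ i - (\<Sum>l\<in>UNIV. A i l h c * e l h c))"
    by blast
  have "uniform_O (Suc (2 * r)) (\<lambda>h c. e i h 1)"
  proof (rule superconvergence[OF r e _ cont_k cont_R A(1) _ A(2)])
    show "\<forall>\<^sub>F h in at_right 0. \<forall>c\<in>{0..1}. k i h c = (\<Sum>l\<in>UNIV. A i l h c * e l h c) + R i h c
        + (f (Y h c) $ i - f (W h c) $ i - (\<Sum>l\<in>UNIV. A i l h c * e l h c))" for i
      by (simp add: k_def R_def)
    show "uniform_O (Suc r) (e i)" for i using uniform_O_e by blast
    show "uniform_O (2 * r) (\<lambda>h c. integral {0..1} (\<lambda>s. G h s * R i h s))" if "graded 0 G" for i G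
      unfolding R_def by (rule residual_graded_integral[OF P cont(2) W_exp(3) that])
  qed
  then show ?thesis by (simp add: e_def)
qed

section \<open>Well-posedness of the truncated problem\<close>

lemma poly_antiderivative:
  fixes p :: "real poly"
  shows "\<exists>q. degree q \<le> Suc (degree p) \<and> poly q 0 = 0 \<and> pderiv q = p"
proof -
  let ?q = "\<Sum>k\<le>degree p. Polynomial.monom (coeff p k / real (Suc k)) (Suc k)"
  have "degree ?q \<le> Suc (degree p)"
    by (intro degree_sum_le) (auto intro: order_trans[OF degree_monom_le])
  moreover have "poly ?q 0 = 0" by (simp add: poly_sum poly_monom)
  moreover have "pderiv ?q = p"
  proof (rule poly_eqI)
    fix n
    have "coeff (pderiv ?q) n = (\<Sum>k\<le>degree p. if k = n then coeff p n else 0)"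
      unfolding coeff_pderiv coeff_sum sum_distrib_left
      by (intro sum.cong) (auto simp: of_nat_neq_0 simp del: of_nat_Suc)
    then show "coeff (pderiv ?q) n = coeff p n" by (simp add: coeff_eq_0)
    qed
  ultimately show ?thesis by blast
qed

text \<open>
  A choice of antiderivative that can be used as a polynomial, so that the solution of the truncated
  problem is visibly a polynomial in \<open>t\<close>.
\<close>
definition antider :: "real poly \<Rightarrow> real poly" where
  "antider p = (SOME q. degree q \<le> Suc (degree p) \<and> poly q 0 = 0 \<and> pderiv q = p)"

lemma antider_properties: "degree (antider p) \<le> Suc (degree p)" "poly (antider p) 0 = 0" "pderiv (antider p) = p"
  using someI_ex[OF poly_antiderivative[of p]] unfolding antider_def by auto

lemma antider_derivative: "(poly (antider p) has_real_derivative poly p x) (at x within S)"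
  using poly_DERIV[of "antider p" x] by (simp add: antider_properties has_field_derivative_at_within)

text \<open>
  The integrated right-hand side of the truncated problem in the variable \<open>c\<close>. Its fixed points on
  \<open>[0,1]\<close> are the solutions of the truncated problem.
\<close>
definition truncation_map ::
  "(nat \<Rightarrow> real poly) \<Rightarrow> nat \<Rightarrow> (real^'m \<Rightarrow> real^'m) \<Rightarrow> real^'m \<Rightarrow> real \<Rightarrow> (real \<Rightarrow> real^'m) \<Rightarrow> real \<Rightarrow> real^'m" where
  "truncation_map P r f y0 h u c =
     y0 + h *\<^sub>R (\<Sum>j<r. poly (antider (P j)) c *\<^sub>R integral {0..1} (\<lambda>\<tau>. poly (P j) \<tau> *\<^sub>R f (u \<tau>)))"

lemma has_vector_derivative_truncation_map:
  fixes f :: "real^'m \<Rightarrow> real^'m"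
  shows "(truncation_map P r f y0 h u has_vector_derivative
     h *\<^sub>R (\<Sum>j<r. poly (P j) c *\<^sub>R integral {0..1} (\<lambda>\<tau>. poly (P j) \<tau> *\<^sub>R f (u \<tau>)))) (at c within S)"
proof -
  have "((\<lambda>c. poly (antider (P j)) c *\<^sub>R v) has_vector_derivative poly (P j) c *\<^sub>R v) (at c within S)" for j and v :: "real^'m"
    using has_vector_derivative_scaleR[OF antider_derivative has_vector_derivative_const] by simp
  then have "((\<lambda>c. \<Sum>j<r. poly (antider (P j)) c *\<^sub>R integral {0..1} (\<lambda>\<tau>. poly (P j) \<tau> *\<^sub>R f (u \<tau>)))
      has_vector_derivative (\<Sum>j<r. poly (P j) c *\<^sub>R integral {0..1} (\<lambda>\<tau>. poly (P j) \<tau> *\<^sub>R f (u \<tau>)))) (at c within S)"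
    by (intro has_vector_derivative_sum)
  from has_vector_derivative_add[OF has_vector_derivative_const
      bounded_linear.has_vector_derivative[OF bounded_linear_scaleR_right this]]
  show ?thesis unfolding truncation_map_def by simp
qed

lemma truncation_map_0: "truncation_map P r f y0 h u 0 = y0"
  by (simp add: truncation_map_def antider_properties)

lemma truncation_map_cong:
  "(\<And>c. c \<in> {0..1} \<Longrightarrow> u c = v c) \<Longrightarrow> truncation_map P r f y0 h u = truncation_map P r f y0 h v"
proof
  fix c assume "\<And>c. c \<in> {0..1} \<Longrightarrow> u c = v c"
  then have "integral {0..1} (\<lambda>\<tau>. poly (P j) \<tau> *\<^sub>R f (u \<tau>)) = integral {0..1} (\<lambda>\<tau>. poly (P j) \<tau> *\<^sub>R f (v \<tau>))" for j
    by (intro integral_cong) simp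
  then show "truncation_map P r f y0 h u c = truncation_map P r f y0 h v c"
    by (simp add: truncation_map_def)
qed

lemma truncated_solution_fixed_point:
  assumes w: "truncated_solution P r f D t0 y0 h w" and c: "c \<in> {0..1}"
  shows "w (t0 + c * h) = truncation_map P r f y0 h (\<lambda>c. w (t0 + c * h)) c"
proof -
  let ?u = "\<lambda>c. w (t0 + c * h)"
  let ?d = "\<lambda>c. h *\<^sub>R (\<Sum>j<r. poly (P j) c *\<^sub>R integral {0..1} (\<lambda>\<tau>. poly (P j) \<tau> *\<^sub>R f (?u \<tau>)))"
  have "(?u has_vector_derivative ?d s) (at s within {0..c})" if s: "s \<in> {0..c}" for s
  proof -
    have "((\<lambda>s. t0 + s * h) has_vector_derivative h) (at s within {0..c})"
      by (auto intro!: derivative_eq_intros simp flip: has_real_derivative_iff_has_vector_derivative)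
    moreover have "(w has_vector_derivative (\<Sum>j<r. poly (P j) s *\<^sub>R \<gamma> P f t0 h j w)) (at (t0 + s * h))"
      using w s c unfolding truncated_solution_def by auto
    ultimately show ?thesis
      using vector_diff_chain_within[of "\<lambda>s. t0 + s * h" h s "{0..c}" w]
      by (auto simp: o_def \<gamma>_def has_vector_derivative_at_within)
  qed
  then have "(?d has_integral ?u c - ?u 0) {0..c}"
    using c by (intro fundamental_theorem_of_calculus) auto
  moreover have "(?d has_integral truncation_map P r f y0 h ?u c - truncation_map P r f y0 h ?u 0) {0..c}"
    using c by (intro fundamental_theorem_of_calculus has_vector_derivative_truncation_map) auto
  ultimately have "?u c - ?u 0 = truncation_map P r f y0 h ?u c - truncation_map P r f y0 h ?u 0"
    by (rule has_integral_unique)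
  then show ?thesis
    using w by (simp add: truncation_map_0 truncated_solution_def)
qed

text \<open>
  The fixed point is only prescribed on \<open>[0,1]\<close>; the right-hand side of the fixed point equation
  is polynomial in \<open>c\<close> and supplies the extension to the whole line.
\<close>
lemma truncated_solution_of_fixed_point:
  fixes f :: "real^'m \<Rightarrow> real^'m"
  assumes deg: "\<And>j. degree (P j) = j" and h: "h > 0"
    and u: "\<And>c. c \<in> {0..1} \<Longrightarrow> u c = truncation_map P r f y0 h u c"
    and D: "\<And>c. c \<in> {0..1} \<Longrightarrow> u c \<in> D"
  shows "truncated_solution P r f D t0 y0 h (\<lambda>t. truncation_map P r f y0 h u ((t - t0) / h))"
    (is "truncated_solution P r f D t0 y0 h ?w")
  unfolding truncated_solution_def
proof (intro conjI ballI)
  let ?g = "\<lambda>j. integral {0..1} (\<lambda>\<tau>. poly (P j) \<tau> *\<^sub>R f (u \<tau>))"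
  have wu: "?w (t0 + c * h) = u c" if "c \<in> {0..1}" for c using u[OF that] h by simp
  show "vec_polynomial r ?w"
  proof -
    define Q where "Q j = pcompose (antider (P j)) [:- t0 / h, 1 / h:]" for j
    have degQ: "degree (Q j) \<le> r" if "j < r" for j
    proof -
      have "degree (Q j) \<le> degree (antider (P j)) * degree [:- t0 / h, 1 / h:]"
        unfolding Q_def by (rule degree_pcompose_le)
      also have "\<dots> \<le> Suc j * 1"
        using antider_properties(1)[of "P j"] by (intro mult_mono) (auto simp: deg)
      finally show ?thesis using that by simp
    qed
    have Q: "poly (antider (P j)) ((t - t0) / h) = (\<Sum>k\<le>r. coeff (Q j) k * t ^ k)" if "j < r" for j t
    proof -
      have "poly (antider (P j)) ((t - t0) / h) = poly (Q j) t"
        by (simp add: Q_def poly_pcompose diff_divide_distrib)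
      also have "\<dots> = (\<Sum>k\<le>r. coeff (Q j) k * t ^ k)"
        by (subst (1) poly_as_sum_of_monoms'[OF degQ[OF that], symmetric]) (simp add: poly_sum poly_monom)
      finally show ?thesis .
    qed
    define a where "a k = (if k = 0 then y0 else 0) + h *\<^sub>R (\<Sum>j<r. coeff (Q j) k *\<^sub>R ?g j)" for k
    have "?w t = (\<Sum>k\<le>r. t ^ k *\<^sub>R a k)" for t
    proof -
      have "(\<Sum>k\<le>r. t ^ k *\<^sub>R a k) = (\<Sum>k\<le>r. t ^ k *\<^sub>R (if k = 0 then y0 else 0))
          + (\<Sum>k\<le>r. h *\<^sub>R (\<Sum>j<r. (coeff (Q j) k * t ^ k) *\<^sub>R ?g j))"
        by (simp add: a_def scaleR_right_distrib sum.distrib scaleR_sum_right mult_ac)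
      also have "(\<Sum>k\<le>r. t ^ k *\<^sub>R (if k = 0 then y0 else 0)) = y0"
        by (simp add: if_distrib[of "\<lambda>v. _ *\<^sub>R v"] cong: if_cong)
      also have "(\<Sum>k\<le>r. h *\<^sub>R (\<Sum>j<r. (coeff (Q j) k * t ^ k) *\<^sub>R ?g j))
          = h *\<^sub>R (\<Sum>j<r. \<Sum>k\<le>r. (coeff (Q j) k * t ^ k) *\<^sub>R ?g j)"
        unfolding scaleR_sum_right[symmetric] by (subst sum.swap) (rule refl)
      also have "\<dots> = h *\<^sub>R (\<Sum>j<r. poly (antider (P j)) ((t - t0) / h) *\<^sub>R ?g j)"
        by (simp add: Q scaleR_sum_left)
      finally show ?thesis by (simp add: truncation_map_def)
    qed
    then show ?thesis unfolding vec_polynomial_def by blast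
  qed
  show "?w t0 = y0" by (simp add: truncation_map_0)
  fix c :: real assume c: "c \<in> {0..1}"
  show "?w (t0 + c * h) \<in> D" using D c by (simp only: wu)
  have "((\<lambda>t. (t - t0) / h) has_vector_derivative 1 / h) (at (t0 + c * h))"
    using h by (auto intro!: derivative_eq_intros simp flip: has_real_derivative_iff_has_vector_derivative)
  from vector_diff_chain_at[OF this has_vector_derivative_truncation_map]
  have "(?w has_vector_derivative (1 / h) *\<^sub>R h *\<^sub>R (\<Sum>j<r. poly (P j) ((t0 + c * h - t0) / h) *\<^sub>R ?g j)) (at (t0 + c * h))"
    by (simp only: o_def)
  moreover have "\<gamma> P f t0 h j ?w = ?g j" for j
    unfolding \<gamma>_def by (intro integral_cong) (simp only: wu)
  moreover have "(t0 + c * h - t0) / h = c" using h by simp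
  moreover have "(1 / h) *\<^sub>R h *\<^sub>R v = v" for v :: "real^'m" using h by simp
  ultimately show "(?w has_vector_derivative (\<Sum>j<r. poly (P j) c *\<^sub>R \<gamma> P f t0 h j ?w)) (at (t0 + c * h))"
    by (simp only:)
qed

lemma vec_polynomial_eqI:
  assumes "vec_polynomial r v" "vec_polynomial r w" and "infinite S" "\<And>t. t \<in> S \<Longrightarrow> v t = w t"
  shows "v = w"
proof -
  obtain a b where a: "\<And>t. v t = (\<Sum>k\<le>r. t ^ k *\<^sub>R a k)" and b: "\<And>t. w t = (\<Sum>k\<le>r. t ^ k *\<^sub>R b k)"
    using assms(1,2) unfolding vec_polynomial_def by blast
  have "v t $ i = w t $ i" for t i
  proof -
    define p where "p = (\<Sum>k\<le>r. Polynomial.monom (a k $ i - b k $ i) k)"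
    have p: "poly p t = v t $ i - w t $ i" for t
      by (simp add: p_def poly_sum poly_monom a b algebra_simps sum_subtractf)
    have "p = 0"
    proof (rule ccontr)
      assume "p \<noteq> 0"
      then have "finite {t. poly p t = 0}" by (rule poly_roots_finite)
      moreover have "S \<subseteq> {t. poly p t = 0}" using assms(4) by (auto simp: p)
      ultimately show False using assms(3) finite_subset by blast
    qed
    then show ?thesis using p[of t] by simp
  qed
  then show ?thesis by (simp add: fun_eq_iff vec_eq_iff)
qed

lemma continuous_on_truncation_map: "continuous_on S (truncation_map P r f y0 h u)"
  using has_vector_derivative_truncation_map by (rule continuous_on_vector_derivative)

text \<open>
  Since \<open>h\<close> multiplies the right-hand side, for small \<open>h\<close> the map sends the continuous functions with values in
  the ball into themselves and contracts by a factor 1/2. Uniqueness on the whole line follows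
  because polynomials that agree on an interval are equal.
\<close>
lemma well_posed_near:
  fixes D :: "(real^'m) set"
  assumes deg: "\<And>j. degree (P j) = j" and \<delta>: "\<delta> > 0" and D: "cball y0 \<delta> \<subseteq> D" and L: "L \<ge> 0"
    and lip: "\<And>z w. z \<in> cball y0 \<delta> \<Longrightarrow> w \<in> cball y0 \<delta> \<Longrightarrow> norm (f z - f w) \<le> L * norm (z - w)"
  shows "\<exists>h1. well_posed_with P r f D t0 y0 \<delta> h1"
proof -
  have "\<exists>B. \<forall>c\<in>{0..1}. \<bar>poly p c\<bar> \<le> B" for p :: "real poly"
  proof -
    have "bounded (poly p ` {0..1})"
      by (intro compact_imp_bounded compact_continuous_image continuous_intros) simp
    then show ?thesis by (auto simp: bounded_iff)
  qed
  then obtain B where B': "\<And>p::real poly. \<forall>c\<in>{0..1}. \<bar>poly p c\<bar> \<le> B p" by metis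
  have B: "\<bar>poly p c\<bar> \<le> B p" if "c \<in> {0..1}" for p :: "real poly" and c
    using B' that by blast
  have B0: "B p \<ge> 0" for p using B[of 0 p] by auto
  define K where "K = (\<Sum>j<r. B (antider (P j)) * B (P j))"
  have K0: "K \<ge> 0" unfolding K_def by (intro sum_nonneg mult_nonneg_nonneg B0)
  have K: "norm (\<Sum>j<r. poly (antider (P j)) c *\<^sub>R v j) \<le> K * b"
    if c: "c \<in> {0..1}" and v: "\<And>j. norm (v j) \<le> B (P j) * b" for c b and v :: "nat \<Rightarrow> real^'m"
  proof -
    have "norm (\<Sum>j<r. poly (antider (P j)) c *\<^sub>R v j) \<le> (\<Sum>j<r. B (antider (P j)) * (B (P j) * b))"
      using B[OF c] v B0 by (intro sum_norm_le) (auto intro!: mult_mono)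
    then show ?thesis by (simp add: K_def sum_distrib_right mult.assoc)
  qed
  define M where "M = norm (f y0) + L * \<delta>"
  have M0: "M \<ge> 0" using L \<delta> by (simp add: M_def)
  have M: "norm (f z) \<le> M" if "z \<in> cball y0 \<delta>" for z
  proof -
    have "norm (f z) \<le> norm (f y0) + norm (f z - f y0)" by norm
    also have "norm (f z - f y0) \<le> L * norm (z - y0)" using that \<delta> by (intro lip) auto
    also have "\<dots> \<le> L * \<delta>" using that L by (intro mult_left_mono) (auto simp: dist_norm norm_minus_commute)
    finally show ?thesis by (simp add: M_def)
  qed
  have cf: "continuous_on (cball y0 \<delta>) f"
    using lip L by (intro lipschitz_on_continuous_on[of L] lipschitz_onI) (auto simp: dist_norm)
  have cPf: "continuous_on {0..1} (\<lambda>\<tau>. poly (P j) \<tau> *\<^sub>R f (u \<tau>))"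
    if "continuous_on {0..1} u" "u ` {0..1} \<subseteq> cball y0 \<delta>" for u j
    using that by (intro continuous_intros continuous_on_compose2[OF cf])
  let ?I = "\<lambda>u j. integral {0..1} (\<lambda>\<tau>. poly (P j) \<tau> *\<^sub>R f (u \<tau>))"
  have stay: "norm (truncation_map P r f y0 h u c - y0) \<le> h * (K * M)"
    if u: "continuous_on {0..1} u" "u ` {0..1} \<subseteq> cball y0 \<delta>" and c: "c \<in> {0..1}" and h: "h > 0" for h u c
  proof -
    have "norm (?I u j) \<le> B (P j) * M" for j
    proof -
      have "norm (?I u j) \<le> B (P j) * M * (1 - 0)"
      proof (intro integral_bound cPf u ballI)
        fix t :: real assume t: "t \<in> {0..1}"
        have "norm (f (u t)) \<le> M" using u(2) t by (intro M) blast
        then show "norm (poly (P j) t *\<^sub>R f (u t)) \<le> B (P j) * M"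
          using B[OF t] B0 by (auto intro!: mult_mono)
      qed simp
      then show ?thesis by simp
    qed
    then have "norm (\<Sum>j<r. poly (antider (P j)) c *\<^sub>R ?I u j) \<le> K * M" by (rule K[OF c])
    then show ?thesis using h by (simp add: truncation_map_def mult_left_mono)
  qed
  have contract: "norm (truncation_map P r f y0 h u c - truncation_map P r f y0 h v c) \<le> h * (K * (L * b))"
    if u: "continuous_on {0..1} u" "u ` {0..1} \<subseteq> cball y0 \<delta>"
      and v: "continuous_on {0..1} v" "v ` {0..1} \<subseteq> cball y0 \<delta>"
      and b: "\<And>c. c \<in> {0..1} \<Longrightarrow> norm (u c - v c) \<le> b" and c: "c \<in> {0..1}" and h: "h > 0" for h u v c b
  proof -
    have "norm (?I u j - ?I v j) \<le> B (P j) * (L * b)" for j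
    proof -
      have "?I u j - ?I v j = integral {0..1} (\<lambda>\<tau>. poly (P j) \<tau> *\<^sub>R f (u \<tau>) - poly (P j) \<tau> *\<^sub>R f (v \<tau>))"
        by (intro integral_diff[symmetric] integrable_continuous_real cPf u v)
      also have "norm \<dots> \<le> B (P j) * (L * b) * (1 - 0)"
      proof (intro integral_bound continuous_on_diff cPf u v ballI)
        fix t :: real assume t: "t \<in> {0..1}"
        have "norm (f (u t) - f (v t)) \<le> L * norm (u t - v t)"
          using u(2) v(2) t by (intro lip) blast+
        also have "\<dots> \<le> L * b" using b[OF t] L by (intro mult_left_mono)
        finally have *: "norm (f (u t) - f (v t)) \<le> L * b" .
        show "norm (poly (P j) t *\<^sub>R f (u t) - poly (P j) t *\<^sub>R f (v t)) \<le> B (P j) * (L * b)"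
          unfolding scaleR_diff_right[symmetric] norm_scaleR real_norm_def
          using B[OF t] * B0 by (intro mult_mono) auto
      qed simp
      finally show ?thesis by simp
    qed
    then have "norm (\<Sum>j<r. poly (antider (P j)) c *\<^sub>R (?I u j - ?I v j)) \<le> K * (L * b)" by (rule K[OF c])
    moreover have "truncation_map P r f y0 h u c - truncation_map P r f y0 h v c
        = h *\<^sub>R (\<Sum>j<r. poly (antider (P j)) c *\<^sub>R (?I u j - ?I v j))"
      by (simp add: truncation_map_def scaleR_diff_right sum_subtractf)
    ultimately show ?thesis using h by (simp add: mult_left_mono)
  qed
  define h1 where "h1 = min (\<delta> / (K * M + 1)) (1 / (2 * (K * L + 1)))"
  have KM: "K * M \<ge> 0" and KL: "K * L \<ge> 0" using K0 M0 L by auto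
  have h1: "h1 > 0" using KM KL \<delta> by (simp add: h1_def add_nonneg_pos)
  have "\<exists>!w. near_solution P r f D t0 y0 \<delta> h w" if h: "h \<in> {0<..h1}" for h
  proof -
    have h0: "h > 0" using h by simp
    have hKM: "h * (K * M) \<le> \<delta>"
    proof -
      have "h * (K * M) \<le> h * (K * M + 1)" using h0 by simp
      also have "\<dots> \<le> \<delta>" using h KM by (simp add: h1_def field_simps)
      finally show ?thesis .
    qed
    have hKL: "h * (K * L) \<le> 1 / 2"
    proof -
      have "h * (K * L) \<le> h * (K * L + 1)" using h0 by simp
      also have "\<dots> \<le> 1 / 2" using h KL by (simp add: h1_def field_simps)
      finally show ?thesis .
    qed
    \<comment> \<open>Composition with the retraction onto \<open>[0,1]\<close> realizes functions on \<open>[0,1]\<close> as bounded continuous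
      functions on the line, which form a complete metric space.\<close>
    define clip :: "real \<Rightarrow> real" where "clip x = max 0 (min 1 x)" for x
    have clip: "clip x \<in> {0..1}" "c \<in> {0..1} \<Longrightarrow> clip c = c" for x c by (auto simp: clip_def)
    have cclip: "continuous_on UNIV clip" unfolding clip_def by (intro continuous_intros)
    define S :: "(real \<Rightarrow>\<^sub>C (real^'m)) set" where "S = PiC UNIV (\<lambda>_. cball y0 \<delta>)"
    have S: "u \<in> S \<longleftrightarrow> (\<forall>x. u x \<in> cball y0 \<delta>)" for u by (auto simp: S_def mem_PiC_iff)
    define \<Phi> where "\<Phi> u = Bcontfun (\<lambda>x. truncation_map P r f y0 h (apply_bcontfun u) (clip x))" for u
    have into: "truncation_map P r f y0 h u (clip x) \<in> cball y0 \<delta>" if "u \<in> S" for u x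
      using stay[of "apply_bcontfun u" "clip x" h] that S[of u] clip(1) h0 hKM
      by (force simp: dist_norm norm_minus_commute)
    have bcI: "v \<in> bcontfun" if "continuous_on UNIV v" "\<And>x. v x \<in> cball y0 \<delta>" for v :: "real \<Rightarrow> real^'m"
    proof (rule bcontfun_normI[OF that(1)])
      fix x
      have "norm (v x) \<le> norm y0 + norm (v x - y0)" by norm
      then show "norm (v x) \<le> norm y0 + \<delta>" using that(2)[of x] by (simp add: dist_norm norm_minus_commute)
    qed
    have \<Phi>: "\<Phi> u x = truncation_map P r f y0 h u (clip x)" if "u \<in> S" for u x
      unfolding \<Phi>_def
      by (subst Bcontfun_inverse)
         (auto intro!: bcI into[OF that] continuous_on_compose2[OF continuous_on_truncation_map[of UNIV] cclip])
    have fix_ex1: "\<exists>!u\<in>S. \<Phi> u = u"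
    proof (rule Banach_fix)
      show "complete S" unfolding S_def by (simp add: complete_eq_closed closed_PiC)
      have "const_bcontfun y0 \<in> S" using \<delta> by (simp add: S const_bcontfun.rep_eq)
      then show "S \<noteq> {}" by blast
      show "\<Phi> ` S \<subseteq> S" using into by (auto simp: S[of "\<Phi> _"] \<Phi> simp del: mem_cball)
      show "dist (\<Phi> u) (\<Phi> v) \<le> 1 / 2 * dist u v" if "u \<in> S" "v \<in> S" for u v
      proof (rule dist_bound)
        fix x
        have "dist (\<Phi> u x) (\<Phi> v x) \<le> h * (K * (L * dist u v))"
          using contract[of "apply_bcontfun u" "apply_bcontfun v" "dist u v" "clip x" h]
            that S[of u] S[of v] clip(1) h0 dist_bounded[of u _ v]
          by (force simp: \<Phi> dist_norm)
        also have "\<dots> = h * (K * L) * dist u v" by simp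
        also have "\<dots> \<le> 1 / 2 * dist u v" using hKL by (intro mult_right_mono) auto
        finally show "dist (\<Phi> u x) (\<Phi> v x) \<le> 1 / 2 * dist u v" .
      qed
    qed auto
    then obtain u where u: "u \<in> S" "\<Phi> u = u" by blast
    have u_fix: "u c = truncation_map P r f y0 h u c" if "c \<in> {0..1}" for c
      using \<Phi>[OF u(1), of c] clip(2)[OF that] u(2) by simp
    show ?thesis
    proof (rule ex_ex1I)
      let ?w = "\<lambda>t. truncation_map P r f y0 h u ((t - t0) / h)"
      have "truncated_solution P r f D t0 y0 h ?w"
        using u(1) S D by (intro truncated_solution_of_fixed_point deg h0 u_fix) auto
      moreover have "norm (?w (t0 + c * h) - y0) \<le> \<delta>" if "c \<in> {0..1}" for c
        using u_fix[OF that, symmetric] u(1) S[of u] h0 by (simp add: dist_norm norm_minus_commute)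
      ultimately show "\<exists>w. near_solution P r f D t0 y0 \<delta> h w" unfolding near_solution_def by blast
    next
      have eq_u: "w (t0 + c * h) = u c" if w: "near_solution P r f D t0 y0 \<delta> h w" and c: "c \<in> {0..1}" for w c
      proof -
        have ts: "truncated_solution P r f D t0 y0 h w" using w by (simp add: near_solution_def)
        then obtain a where "w = (\<lambda>t. \<Sum>k\<le>r. t ^ k *\<^sub>R a k)"
          unfolding truncated_solution_def vec_polynomial_def by blast
        then have "continuous_on UNIV w" by (simp add: continuous_intros)
        then have "continuous_on UNIV (\<lambda>x. w (t0 + clip x * h))"
          by (rule continuous_on_compose2) (auto intro!: continuous_intros cclip)
        moreover have "w (t0 + clip x * h) \<in> cball y0 \<delta>" for x
          using w clip(1)[of x] by (auto simp: near_solution_def dist_norm norm_minus_commute)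
        ultimately have "(\<lambda>x. w (t0 + clip x * h)) \<in> bcontfun" by (rule bcI)
        then obtain v where v: "(\<lambda>x. w (t0 + clip x * h)) = apply_bcontfun v" by (rule bcontfunE)
        have vS: "v \<in> S" using \<open>\<And>x. w (t0 + clip x * h) \<in> cball y0 \<delta>\<close> unfolding S v[symmetric] by blast
        have "\<Phi> v = v"
        proof (rule bcontfun_eqI)
          fix x
          have "\<Phi> v x = truncation_map P r f y0 h (\<lambda>c. w (t0 + c * h)) (clip x)"
            unfolding \<Phi>[OF vS] v[symmetric] using clip(2) by (subst truncation_map_cong) auto
          also have "\<dots> = v x"
            using truncated_solution_fixed_point[OF ts clip(1)] fun_cong[OF v, of x] by simp
          finally show "\<Phi> v x = v x" .
        qed
        then have "v = u" using fix_ex1 u vS by blast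
        then show ?thesis using fun_cong[OF v, of c] clip(2)[OF c] by simp
      qed
      fix w1 w2
      assume w: "near_solution P r f D t0 y0 \<delta> h w1" "near_solution P r f D t0 y0 \<delta> h w2"
      show "w1 = w2"
      proof (rule vec_polynomial_eqI)
        show "vec_polynomial r w1" "vec_polynomial r w2"
          using w by (auto simp: near_solution_def truncated_solution_def)
        show "infinite {t0..t0 + h}" using h0 by (simp add: infinite_Icc)
        fix t assume t: "t \<in> {t0..t0 + h}"
        then have "(t - t0) / h \<in> {0..1}" using h0 by (simp add: field_simps)
        from eq_u[OF w(1) this] eq_u[OF w(2) this] show "w1 t = w2 t" using h0 by simp
      qed
    qed
  qed
  then show ?thesis using \<delta> h1 unfolding well_posed_with_def by blast
qed

section \<open>The exact solution and the truncated problem on the unit interval\<close>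

lemma component_integral_equation:
  fixes u :: "real \<Rightarrow> real^'m"
  assumes "\<And>c. c \<in> {0..1} \<Longrightarrow> (u has_vector_derivative h *\<^sub>R g c) (at c within {0..1})" and "c \<in> {0..1}"
  shows "u c $ i = u 0 $ i + h * integral {0..c} (\<lambda>s. g s $ i)"
proof -
  have "((\<lambda>s. u s $ i) has_vector_derivative h * g s $ i) (at s within {0..c})" if "s \<in> {0..c}" for s
    using bounded_linear.has_vector_derivative[OF bounded_linear_vec_nth
        has_vector_derivative_within_subset[OF assms(1)[of s], of "{0..c}"], of i] assms(2) that by simp
  then have "((\<lambda>s. h * g s $ i) has_integral u c $ i - u 0 $ i) {0..c}"
    using assms(2) by (intro fundamental_theorem_of_calculus) auto
  then have "integral {0..c} (\<lambda>s. h * g s $ i) = u c $ i - u 0 $ i" by (rule integral_unique)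
  then show ?thesis by simp
qed

text \<open>
  At the first time of distance \<open>d\<close> from \<open>y0\<close> the mean value inequality bounds the distance by
  \<open>h * M\<close>, as the solution has run inside the ball until then.
\<close>
lemma ivp_solution_stays_near:
  assumes y: "ivp_solution f D t0 y0 h y" and h: "0 < h" and d0: "0 < d" and d: "h * M < d"
    and M: "\<And>z. z \<in> cball y0 d \<Longrightarrow> norm (f z) \<le> M" and t: "t \<in> {t0..t0 + h}"
  shows "y t \<in> cball y0 d"
proof (rule ccontr)
  assume not: "y t \<notin> cball y0 d"
  have der: "(y has_vector_derivative f (y s)) (at s within {t0..t0 + h})" if "s \<in> {t0..t0 + h}" for s
    using y that by (auto simp: ivp_solution_def)
  have cy: "continuous_on {t0..t0 + h} y"
    using der by (rule continuous_on_vector_derivative)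
  define S where "S = {t0..t0 + h} \<inter> (\<lambda>s. norm (y s - y0)) -` {d..}"
  have "closed S" unfolding S_def
    by (intro continuous_closed_preimage continuous_intros cy)
  moreover have "bounded S" unfolding S_def by (rule bounded_subset[of "{t0..t0 + h}"]) auto
  ultimately have "compact S" by (simp add: compact_eq_bounded_closed)
  moreover have "t \<in> S" using t not by (simp add: S_def dist_norm norm_minus_commute)
  ultimately obtain \<tau> where \<tau>: "\<tau> \<in> S" "\<And>s. s \<in> S \<Longrightarrow> \<tau> \<le> s"
    using compact_attains_inf[of S] by blast
  have \<tau>_in: "\<tau> \<in> {t0..t0 + h}" and \<tau>_far: "norm (y \<tau> - y0) \<ge> d" using \<tau>(1) by (auto simp: S_def)
  have y0: "y t0 = y0" using y by (simp add: ivp_solution_def)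
  have "\<tau> \<noteq> t0" using \<tau>_far y0 d0 by auto
  then have less: "t0 < \<tau>" using \<tau>_in by simp
  have der_at: "(y has_derivative (\<lambda>v. v *\<^sub>R f (y s))) (at s)" if "t0 < s" "s < \<tau>" for s
  proof -
    have "s \<in> interior {t0..t0 + h}" using that \<tau>_in by simp
    then have "at s within {t0..t0 + h} = at s" by (rule at_within_interior)
    then show ?thesis
      using der[of s] that \<tau>_in by (simp add: has_vector_derivative_def)
  qed
  have "continuous_on {t0..\<tau>} y" using \<tau>_in by (intro continuous_on_subset[OF cy]) auto
  from mvt_general[OF less this der_at]
  obtain s where s: "t0 < s" "s < \<tau>" "norm (y \<tau> - y t0) \<le> norm ((\<tau> - t0) *\<^sub>R f (y s))"
    by auto
  have "s \<notin> S"
  proof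
    assume "s \<in> S"
    then have "\<tau> \<le> s" by (rule \<tau>(2))
    then show False using s(2) by simp
  qed
  then have "y s \<in> cball y0 d" using s \<tau>_in by (auto simp: S_def dist_norm norm_minus_commute)
  then have fM: "norm (f (y s)) \<le> M" by (rule M)
  have "norm ((\<tau> - t0) *\<^sub>R f (y s)) = (\<tau> - t0) * norm (f (y s))" using s by simp
  also have "\<dots> \<le> h * M" using fM \<tau>_in s by (intro mult_mono) auto
  finally show False using s(3) \<tau>_far d y0 by simp
qed

lemma component_truncation_derivative:
  fixes f :: "real^'m \<Rightarrow> real^'m"
  assumes "continuous_on {0..1} (\<lambda>\<tau>. f (u \<tau>))"
  shows "(\<Sum>j<r. poly (P j) c *\<^sub>R integral {0..1} (\<lambda>\<tau>. poly (P j) \<tau> *\<^sub>R f (u \<tau>))) $ i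
    = proj P r (\<lambda>\<tau>. f (u \<tau>) $ i) c"
proof -
  have "integral {0..1} (\<lambda>\<tau>. poly (P j) \<tau> *\<^sub>R f (u \<tau>)) $ i = integral {0..1} (\<lambda>\<tau>. poly (P j) \<tau> * f (u \<tau>) $ i)" for j
    using integral_linear[OF integrable_continuous_real bounded_linear_vec_nth[of i],
        of 0 1 "\<lambda>\<tau>. poly (P j) \<tau> *\<^sub>R f (u \<tau>)"] assms
    by (simp add: o_def continuous_intros)
  then show ?thesis by (simp add: proj_def)
qed

theorem theorem2p2:
  fixes D :: "(real^'m) set" and f :: "real^'m \<Rightarrow> real^'m"
    and t0 :: real and y0 :: "real^'m" and r :: nat and P :: "nat \<Rightarrow> real poly"
  assumes "open D" and "real_analytic_on f D" and "y0 \<in> D" and "r \<ge> 1"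
    and "orthonormal_legendre P"
  shows "(\<exists>\<delta> h0. well_posed_with P r f D t0 y0 \<delta> h0) \<and>
    (\<forall>\<delta> h0 (y :: real \<Rightarrow> real \<Rightarrow> real^'m) (\<omega> :: real \<Rightarrow> real \<Rightarrow> real^'m).
       well_posed_with P r f D t0 y0 \<delta> h0 \<longrightarrow>
       (\<forall>h\<in>{0<..h0}. near_solution P r f D t0 y0 \<delta> h (\<omega> h)) \<longrightarrow>
       (\<forall>\<^sub>F h in at_right 0. ivp_solution f D t0 y0 h (y h)) \<longrightarrow>
       (\<lambda>h. norm (y h (t0 + h) - \<omega> h (t0 + h))) \<in> O[at_right 0](\<lambda>h. h ^ (2 * r + 1)))"
proof -
  note P = \<open>orthonormal_legendre P\<close>
  obtain d L where d: "d > 0" "cball y0 d \<subseteq> D" and L: "L \<ge> 0"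
    and lip: "\<And>z w i. z \<in> cball y0 d \<Longrightarrow> w \<in> cball y0 d \<Longrightarrow> \<bar>f z $ i - f w $ i\<bar> \<le> L * norm (z - w)"
    and taylor: "\<And>N i. \<exists>T. real_polynomial_function T \<and>
       (\<exists>C. \<forall>z\<in>cball y0 d. \<bar>f z $ i - T z\<bar> \<le> C * norm (z - y0) ^ N)"
    using real_analytic_on_local[OF assms(2,3)] by blast
  define K where "K = CARD('m) * L"
  have K0: "K \<ge> 0" using L by (simp add: K_def)
  have lipK: "norm (f z - f w) \<le> K * norm (z - w)" if "z \<in> cball y0 d" "w \<in> cball y0 d" for z w
  proof -
    have "norm (f z - f w) \<le> (\<Sum>i\<in>UNIV. \<bar>(f z - f w) $ i\<bar>)" by (rule norm_le_l1_cart)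
    also have "\<dots> \<le> (\<Sum>i::'m\<in>UNIV. L * norm (z - w))"
      using lip[OF that] by (intro sum_mono) simp
    finally show ?thesis by (simp add: K_def)
  qed
  have wp: "\<exists>h1. well_posed_with P r f D t0 y0 \<delta> h1" if \<delta>: "0 < \<delta>" "\<delta> \<le> d" for \<delta>
  proof (rule well_posed_near[OF _ \<delta>(1) _ K0])
    show "degree (P j) = j" for j using P by (simp add: orthonormal_legendre_def)
    have sub: "cball y0 \<delta> \<subseteq> cball y0 d" using \<delta> by (rule_tac subset_cball)
    then show "cball y0 \<delta> \<subseteq> D" using d by blast
    show "norm (f z - f w) \<le> K * norm (z - w)" if "z \<in> cball y0 \<delta>" "w \<in> cball y0 \<delta>" for z w
      using that sub by (intro lipK) blast+
  qed
  have cf: "continuous_on (cball y0 d) f"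
    using lipK K0 by (intro lipschitz_on_continuous_on[of K] lipschitz_onI) (auto simp: dist_norm)
  have "bounded (f ` cball y0 d)"
    by (intro compact_imp_bounded compact_continuous_image cf) simp
  then obtain M where M: "\<And>z. z \<in> cball y0 d \<Longrightarrow> norm (f z) \<le> M"
    unfolding bounded_iff by blast
  have M0: "M \<ge> 0" using M[of y0] d norm_ge_zero[of "f y0"] by (simp del: norm_ge_zero)
  show ?thesis
  proof (intro conjI allI impI)
    show "\<exists>\<delta> h0. well_posed_with P r f D t0 y0 \<delta> h0" using wp[OF d(1)] by blast
  next
    fix \<delta> h0 and y \<omega> :: "real \<Rightarrow> real \<Rightarrow> real^'m"
    assume wp0: "well_posed_with P r f D t0 y0 \<delta> h0"
      and \<omega>: "\<forall>h\<in>{0<..h0}. near_solution P r f D t0 y0 \<delta> h (\<omega> h)"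
      and y: "\<forall>\<^sub>F h in at_right 0. ivp_solution f D t0 y0 h (y h)"
    define W where "W h c = \<omega> h (t0 + c * h)" for h c
    define Y where "Y h c = y h (t0 + c * h)" for h c
    have \<omega>_near: "\<forall>\<^sub>F h in at_right 0. truncated_solution P r f D t0 y0 h (\<omega> h) \<and> (\<forall>c\<in>{0..1}. W h c \<in> cball y0 d)"
    proof -
      \<comment> \<open>The solution with radius \<open>\<delta>'\<close> is also one with radius \<open>\<delta>\<close>, so it equals \<open>\<omega> h\<close>, which
        therefore stays in the ball of radius \<open>d\<close> where the bounds on \<open>f\<close> hold.\<close>
      define \<delta>' where "\<delta>' = min \<delta> d"
      have "\<delta> > 0" "h0 > 0" using wp0 by (auto simp: well_posed_with_def)
      then obtain h1 where h1: "well_posed_with P r f D t0 y0 \<delta>' h1"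
        using wp[of \<delta>'] d by (auto simp: \<delta>'_def)
      then have "h1 > 0" by (simp add: well_posed_with_def)
      show ?thesis
        using at_right_0_less[OF \<open>h0 > 0\<close>] at_right_0_less[OF \<open>h1 > 0\<close>]
      proof eventually_elim
        case (elim h)
        have "\<exists>!w. near_solution P r f D t0 y0 \<delta>' h w"
          using h1 elim by (simp add: well_posed_with_def)
        then obtain w where w: "near_solution P r f D t0 y0 \<delta>' h w" by blast
        then have "near_solution P r f D t0 y0 \<delta> h w"
          by (auto simp: near_solution_def \<delta>'_def)
        moreover have "near_solution P r f D t0 y0 \<delta> h (\<omega> h)" using \<omega> elim by simp
        moreover have "\<exists>!w. near_solution P r f D t0 y0 \<delta> h w"
          using wp0 elim by (simp add: well_posed_with_def)
        ultimately have "w = \<omega> h" by blast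
        then show ?case
          using w by (auto simp: near_solution_def \<delta>'_def W_def dist_norm norm_minus_commute)
      qed
    qed
    have y_near: "\<forall>\<^sub>F h in at_right 0. 0 < h \<and> ivp_solution f D t0 y0 h (y h) \<and> (\<forall>c\<in>{0..1}. Y h c \<in> cball y0 d)"
    proof -
      have "d / (M + 1) > 0" using d M0 by simp
      from y at_right_0_less[OF this] show ?thesis
      proof eventually_elim
        case (elim h)
        then have h: "0 < h" by simp
        have "h * M < h * (M + 1)" using h by simp
        also have "\<dots> \<le> d" using elim M0 by (simp add: field_simps)
        finally have hM: "h * M < d" .
        have "Y h c \<in> cball y0 d" if c: "c \<in> {0..1}" for c
          unfolding Y_def
        proof (rule ivp_solution_stays_near[OF elim(1) h d(1) hM M])
          have "c * h \<le> 1 * h" using c h by (intro mult_right_mono) auto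
          then show "t0 + c * h \<in> {t0..t0 + h}" using c h by simp
        qed
        then show ?case using elim h by blast
      qed
    qed
    have Y_der: "\<forall>\<^sub>F h in at_right 0. \<forall>c\<in>{0..1}. (Y h has_vector_derivative h *\<^sub>R f (Y h c)) (at c within {0..1})"
      using y_near
    proof eventually_elim
      case (elim h)
      show ?case
      proof
        fix c :: real assume c: "c \<in> {0..1}"
        have img: "(\<lambda>c. t0 + c * h) ` {0..1} \<subseteq> {t0..t0 + h}"
          using elim by (auto intro: mult_left_le_one_le)
        then have "(y h has_vector_derivative f (y h (t0 + c * h))) (at (t0 + c * h) within (\<lambda>c. t0 + c * h) ` {0..1})"
          using elim c by (intro has_vector_derivative_within_subset[OF _ img]) (auto simp: ivp_solution_def)
        moreover have "((\<lambda>c. t0 + c * h) has_vector_derivative h) (at c within {0..1})"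
          by (auto intro!: derivative_eq_intros simp flip: has_real_derivative_iff_has_vector_derivative)
        ultimately show "(Y h has_vector_derivative h *\<^sub>R f (Y h c)) (at c within {0..1})"
          using vector_diff_chain_within[of "\<lambda>c. t0 + c * h" h c "{0..1}" "y h"]
          by (simp add: o_def Y_def[abs_def])
      qed
    qed
    have cont_fY: "\<forall>\<^sub>F h in at_right 0. continuous_on {0..1} (\<lambda>s. f (Y h s))"
      using y_near Y_der
    proof eventually_elim
      case (elim h)
      have "continuous_on {0..1} (Y h)" using elim(2) by (intro continuous_on_vector_derivative) blast
      then show ?case by (rule continuous_on_compose2[OF cf]) (use elim in blast)
    qed
    have Y_eq: "\<forall>\<^sub>F h in at_right 0. \<forall>c\<in>{0..1}. Y h c $ i = y0 $ i + h * integral {0..c} (\<lambda>s. f (Y h s) $ i)" for i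
      using y_near Y_der
    proof eventually_elim
      case (elim h)
      have "Y h 0 = y0" using elim by (simp add: Y_def ivp_solution_def)
      then show ?case using component_integral_equation[of "Y h" h "\<lambda>s. f (Y h s)"] elim(2) by auto
    qed
    have W_fix: "\<forall>\<^sub>F h in at_right 0. \<forall>c\<in>{0..1}. truncation_map P r f y0 h (W h) c = W h c"
      using \<omega>_near
    proof eventually_elim
      case (elim h)
      then show ?case
        unfolding W_def[abs_def] by (blast intro: truncated_solution_fixed_point[symmetric])
    qed
    have cont_fW: "\<forall>\<^sub>F h in at_right 0. continuous_on {0..1} (\<lambda>s. f (W h s))"
      using \<omega>_near W_fix
    proof eventually_elim
      case (elim h)
      have "continuous_on {0..1} (W h)"
        using continuous_on_truncation_map by (rule continuous_on_eq) (use elim in blast)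
      then show ?case by (rule continuous_on_compose2[OF cf]) (use elim in blast)
    qed
    have W_eq: "\<forall>\<^sub>F h in at_right 0. \<forall>c\<in>{0..1}.
        W h c $ i = y0 $ i + h * integral {0..c} (proj P r (\<lambda>s. f (W h s) $ i))" for i
      using W_fix cont_fW
    proof eventually_elim
      case (elim h)
      show ?case
      proof
        fix c :: real assume c: "c \<in> {0..1}"
        have "truncation_map P r f y0 h (W h) c $ i
            = y0 $ i + h * integral {0..c} (proj P r (\<lambda>s. f (W h s) $ i))"
          using component_integral_equation[OF has_vector_derivative_truncation_map[of P r f y0 h "W h"] c, of i]
          unfolding truncation_map_0 component_truncation_derivative[where f = f and u = "W h", OF elim(2)] by simp
        then show "W h c $ i = y0 $ i + h * integral {0..c} (proj P r (\<lambda>s. f (W h s) $ i))"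
          using elim(1) c by simp
      qed
    qed
    have "uniform_O (Suc (2 * r)) (\<lambda>h c. (Y h 1 - W h 1) $ i)" for i
    proof (rule truncation_error[OF P assms(4) L taylor lip _ _ Y_eq W_eq])
      show "\<forall>\<^sub>F h in at_right 0. \<forall>c\<in>{0..1}. Y h c \<in> cball y0 d"
        using y_near by eventually_elim blast
      show "\<forall>\<^sub>F h in at_right 0. \<forall>c\<in>{0..1}. W h c \<in> cball y0 d"
        using \<omega>_near by eventually_elim blast
      show "\<forall>\<^sub>F h in at_right 0. continuous_on {0..1} (\<lambda>s. f (Y h s) $ i)" for i
        using cont_fY by eventually_elim (intro continuous_intros)
      show "\<forall>\<^sub>F h in at_right 0. continuous_on {0..1} (\<lambda>s. f (W h s) $ i)" for i
        using cont_fW by eventually_elim (intro continuous_intros)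
    qed
    from uniform_O_norm_components[of _ "\<lambda>h c. Y h 1 - W h 1", OF this]
    obtain C where "\<forall>\<^sub>F h in at_right 0. 0 < h \<and> h \<le> 1 \<and> (\<forall>c\<in>{0..1::real}. \<bar>norm (Y h 1 - W h 1)\<bar> \<le> C * h ^ Suc (2 * r))"
      by (rule uniform_O_E)
    then have "\<forall>\<^sub>F h in at_right 0. norm (norm (y h (t0 + h) - \<omega> h (t0 + h))) \<le> C * norm (h ^ (2 * r + 1))"
      by eventually_elim (auto simp: Y_def W_def)
    then show "(\<lambda>h. norm (y h (t0 + h) - \<omega> h (t0 + h))) \<in> O[at_right 0](\<lambda>h. h ^ (2 * r + 1))"
      by (rule bigoI)
  qed
qed

end
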